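(* Let $N,p,q$ be real numbers such that $$0<q<2<p\quad\text{and}\quad 2<N<\frac{2(p-q)}{p-2},$$ and let $(X,d,\mathfrak m)$ be an essentially non-branching metric measure space satisfying the measure contraction property $\mathrm{MCP}(0,N)$. Then the following two statements are equivalent: (a) There exists $x_0\in X$ such that $$\left(\int_X |\mathrm{lip}\,u|^2\,\mathrm d\mathfrak m\right)\left(\int_X \frac{|u|^{2p-2}}{d_{x_0}^{2q-2}}\,\mathrm d\mathfrak m\right)\ \ge\ \frac{(N-q)^2}{p^2}\left(\int_X \frac{|u|^p}{d_{x_0}^{q}}\,\mathrm d\mathfrak m\right)^2\qquad\text{for all } u\in \mathrm{Lip}_c(X,d),$$ and the constant $\frac{(N-q)^2}{p^2}$ is sharp in this inequality (for this $x_0$). (b) $(X,d,\mathfrak m)$ is a volume cone, i.e. there exists $x_0\in X$ such that $$\frac{\mathfrak m(B_R(x_0))}{\mathfrak m(B_r(x_0))}=\left(\frac{R}{r}\right)^N\qquad\text{for all } 0<r<R.$$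
   Context: Metric measure space: a triple $(X,d,\mathfrak m)$ where $(X,d)$ is a complete and separable metric space and $\mathfrak m$ is a Radon measure on $X$ with $0<\mathfrak m(U)<\infty$ for every non-empty bounded open set $U\subset X$ (in particular $\mathrm{supp}\,\mathfrak m=X$). Let $\mathrm{Geo}(X):=\{\gamma\in C([0,1],X): d(\gamma_s,\gamma_t)=|s-t|\,d(\gamma_0,\gamma_1)\ \forall s,t\in[0,1]\}$. It is assumed that $(X,d)$ is geodesic: for all $x,y\in X$ there is $\gamma\in\mathrm{Geo}(X)$ with $\gamma_0=x$, $\gamma_1=y$. Notation: $B_r(x_0):=\{x\in X: d(x_0,x)<r\}$; $d_{x_0}(x):=d(x_0,x)$; $\mathrm{Lip}_c(X,d)$ is the space of real-valued Lipschitz functions on $X$ with compact support; the local Lipschitz constant is $\mathrm{lip}\,u(x):=\limsup_{y\to x}\frac{|u(y)-u(x)|}{d(x,y)}$. A constant in such an inequality is sharp if it cannot be replaced by a larger one. Optimal transport: $\mathscr P(X)$ is the set of Borel probability measures on $X$, $\mathscr P_2(X)$ the subset of those with finite second moment, and $W_2^2(\mu_0,\mu_1):=\inf_\pi\int_{X\times X} d^2(x,y)\,\pi(\mathrm dx\,\mathrm dy)$, the infimum being over all $\pi\in\mathscr P(X\times X)$ with first marginal $\mu_0$ and second marginal $\mu_1$. Let $e_t:\mathrm{Geo}(X)\to X$, $e_t(\gamma):=\gamma_t$. $\mathrm{OptGeo}(\mu_0,\mu_1)$ is the set of all $\nu\in\mathscr P(\mathrm{Geo}(X))$ such that $(e_0,e_1)_\sharp\nu$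 has marginals $\mu_0,\mu_1$ and attains the infimum defining $W_2^2(\mu_0,\mu_1)$. Essentially non-branching: a set $G\subset\mathrm{Geo}(X)$ is a set of non-branching geodesics if for any $\gamma^1,\gamma^2\in G$: whenever there is $t\in(0,1)$ with $\gamma^1_s=\gamma^2_s$ for all $s\in[0,t]$, then $\gamma^1_s=\gamma^2_s$ for all $s\in[0,1]$. The space $(X,d,\mathfrak m)$ is essentially non-branching if for any $\mu_0,\mu_1\in\mathscr P_2(X)$ with $\mu_0,\mu_1\ll\mathfrak m$, every element of $\mathrm{OptGeo}(\mu_0,\mu_1)$ is concentrated on a set of non-branching geodesics. $\mathrm{MCP}(0,N)$: $(X,d,\mathfrak m)$ satisfies $\mathrm{MCP}(0,N)$ if for every Borel set $A\subset X$ with $\mathfrak m(A)\in(0,\infty)$ such that $\mu_0:=\frac{1}{\mathfrak m(A)}\mathfrak m\llcorner_A\in\mathscr P_2(X)$, and every $o\in X$, there exists $\nu\in\mathrm{OptGeo}(\mu_0,\delta_o)$ such that $$\frac{1}{\mathfrak m(A)}\,\mathfrak m\ \ge\ (e_t)_\sharp\big((1-t)^N\,\nu\big)\qquad\text{for all } t\in[0,1].$$ (This is the general $\mathrm{MCP}(K,N)$ condition at $K=0$, where the distortion coefficient is $\tau^{(1-t)}_{0,N}(\theta)=1-t$.)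
   Formalization: In (a) the three integrals are also required to be finite for every u in Lip_c; if infinite ≥ infinite counted as true, the claim would fail, e.g. on the real line with Lebesgue measure, x_0=0, q=3/2, 2<p<5/2, N=p+1. *)

theory Defs
  imports "HOL-Probability.Probability"
begin

text \<open>
  A complete separable metric space \<open>(X, d)\<close> is a type of class \<open>polish_space\<close> (which bundles a
  complete metric with second countability of its topology), and \<open>d\<close> is \<open>dist\<close>.
\<close>

definition radon_measure :: "'a::metric_space measure \<Rightarrow> bool" where
  "radon_measure m \<longleftrightarrow>
     sets m = sets borel \<and>
     (\<forall>x. \<exists>U. open U \<and> x \<in> U \<and> emeasure m U < \<infinity>) \<and>
     (\<forall>B\<in>sets borel. emeasure m B = (SUP K\<in>{K. compact K \<and> K \<subseteq> B}. emeasure m K))"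

definition metric_measure_space :: "'a::polish_space measure \<Rightarrow> bool" where
  "metric_measure_space m \<longleftrightarrow>
     radon_measure m \<and>
     (\<forall>U. open U \<and> bounded U \<and> U \<noteq> {} \<longrightarrow> 0 < emeasure m U \<and> emeasure m U < \<infinity>)"

subsection \<open>Geodesics\<close>

text \<open>\<open>C([0,1], X)\<close> with the sup distance; its elements are extensional on \<open>{0..1}\<close>.\<close>

abbreviation C01 :: "(real \<Rightarrow> 'a::metric_space) metric" where
  "C01 \<equiv> cfunspace (top_of_set {0..1}) euclidean_metric"

definition Geo :: "(real \<Rightarrow> 'a::metric_space) set" where
  "Geo = {\<gamma> \<in> mspace C01.
     \<forall>s\<in>{0..1}. \<forall>t\<in>{0..1}. dist (\<gamma> s) (\<gamma> t) = \<bar>s - t\<bar> * dist (\<gamma> 0) (\<gamma> 1)}"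

text \<open>\<open>Geo\<close> with the Borel \<open>\<sigma>\<close>-algebra of the sup distance (only the \<open>\<sigma>\<close>-algebra matters).\<close>

definition Geo_borel :: "(real \<Rightarrow> 'a::metric_space) measure" where
  "Geo_borel = sigma Geo {U. openin (subtopology (mtopology_of C01) Geo) U}"

definition geodesic_space :: "'a::metric_space itself \<Rightarrow> bool" where
  "geodesic_space _ \<longleftrightarrow> (\<forall>x y :: 'a. \<exists>\<gamma>\<in>Geo. \<gamma> 0 = x \<and> \<gamma> 1 = y)"

subsection \<open>Optimal transport\<close>

definition borel_probs :: "'a::topological_space measure set" where
  "borel_probs = {\<mu>. sets \<mu> = sets borel \<and> prob_space \<mu>}"

definition borel_probs2 :: "'a::metric_space measure set" where
  "borel_probs2 =
     {\<mu> \<in> borel_probs. \<exists>x. (\<integral>\<^sup>+ y. ennreal ((dist x y)\<^sup>2) \<partial>\<mu>) < \<infinity>}"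

definition couplings ::
    "'a::metric_space measure \<Rightarrow> 'a measure \<Rightarrow> ('a \<times> 'a) measure set" where
  "couplings \<mu>0 \<mu>1 =
     {\<pi> \<in> borel_probs. distr \<pi> borel fst = \<mu>0 \<and> distr \<pi> borel snd = \<mu>1}"

definition transport_cost :: "('a::metric_space \<times> 'a) measure \<Rightarrow> ennreal" where
  "transport_cost \<pi> = (\<integral>\<^sup>+ z. ennreal ((dist (fst z) (snd z))\<^sup>2) \<partial>\<pi>)"

definition W2_squared :: "'a::metric_space measure \<Rightarrow> 'a measure \<Rightarrow> ennreal" where
  "W2_squared \<mu>0 \<mu>1 = (INF \<pi>\<in>couplings \<mu>0 \<mu>1. transport_cost \<pi>)"

definition OptGeo ::
    "'a::metric_space measure \<Rightarrow> 'a measure \<Rightarrow> (real \<Rightarrow> 'a) measure set" where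
  "OptGeo \<mu>0 \<mu>1 =
     {\<nu>. sets \<nu> = sets Geo_borel \<and> prob_space \<nu> \<and>
         distr \<nu> borel (\<lambda>\<gamma>. (\<gamma> 0, \<gamma> 1)) \<in> couplings \<mu>0 \<mu>1 \<and>
         transport_cost (distr \<nu> borel (\<lambda>\<gamma>. (\<gamma> 0, \<gamma> 1))) = W2_squared \<mu>0 \<mu>1}"

subsection \<open>Essential non-branching and \<open>MCP(0,N)\<close>\<close>

definition nonbranching_geodesics :: "(real \<Rightarrow> 'a::metric_space) set \<Rightarrow> bool" where
  "nonbranching_geodesics G \<longleftrightarrow> G \<subseteq> Geo \<and>
     (\<forall>\<gamma>1\<in>G. \<forall>\<gamma>2\<in>G.
        (\<exists>t\<in>{0<..<1}. \<forall>s\<in>{0..t}. \<gamma>1 s = \<gamma>2 s) \<longrightarrow> (\<forall>s\<in>{0..1}. \<gamma>1 s = \<gamma>2 s))"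

text \<open>
  The set \<open>G\<close> below need not be measurable: \<open>\<nu>\<close> is concentrated on it if its complement is
  contained in a \<open>\<nu>\<close>-null set.
\<close>

definition essentially_nonbranching :: "'a::polish_space measure \<Rightarrow> bool" where
  "essentially_nonbranching m \<longleftrightarrow>
     (\<forall>\<mu>0\<in>borel_probs2. \<forall>\<mu>1\<in>borel_probs2.
        absolutely_continuous m \<mu>0 \<and> absolutely_continuous m \<mu>1 \<longrightarrow>
        (\<forall>\<nu>\<in>OptGeo \<mu>0 \<mu>1. \<exists>G. nonbranching_geodesics G \<and> (AE \<gamma> in \<nu>. \<gamma> \<in> G)))"

definition MCP0 :: "'a::polish_space measure \<Rightarrow> real \<Rightarrow> bool" where
  "MCP0 m N \<longleftrightarrow>
     (\<forall>A\<in>sets borel. \<forall>o'.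
        0 < emeasure m A \<and> emeasure m A < \<infinity> \<and> uniform_measure m A \<in> borel_probs2 \<longrightarrow>
        (\<exists>\<nu>\<in>OptGeo (uniform_measure m A) (return borel o').
           \<forall>t\<in>{0..1}. \<forall>B\<in>sets borel.
             emeasure (distr (scale_measure (ennreal ((1 - t) powr N)) \<nu>) borel (\<lambda>\<gamma>. \<gamma> t)) B
               \<le> emeasure (scale_measure (1 / emeasure m A) m) B))"

subsection \<open>The Caffarelli--Kohn--Nirenberg inequality\<close>

definition Lip_c :: "('a::metric_space \<Rightarrow> real) set" where
  "Lip_c = {u. (\<exists>L. L-lipschitz_on UNIV u) \<and> compact (closure {x. u x \<noteq> 0})}"

text \<open>At an isolated point \<open>x\<close> the filter \<open>at x\<close> is trivial and \<open>loc_lip u x = 0\<close>.\<close>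

definition loc_lip :: "('a::metric_space \<Rightarrow> real) \<Rightarrow> 'a \<Rightarrow> ennreal" where
  "loc_lip u x = Limsup (at x) (\<lambda>y. ennreal (\<bar>u y - u x\<bar> / dist x y))"

text \<open>
  The power \<open>r\<^sup>a\<close> for \<open>r \<ge> 0\<close> with the limiting values at \<open>r = 0\<close>, as opposed to
  \<open>0 powr a = 0\<close>. The exponent \<open>2 * q - 2\<close> of the weight below may be negative, zero or positive,
  so the weight \<open>1 / d\<^sup>a\<close> at the vertex has to be \<open>0\<close>, \<open>1\<close> or \<open>\<infinity>\<close> accordingly.
\<close>

definition epowr :: "real \<Rightarrow> real \<Rightarrow> ennreal" where
  "epowr r a =
     (if r = 0 then (if a > 0 then 0 else if a = 0 then 1 else \<infinity>) else ennreal (r powr a))"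

text \<open>
  The inequality is one between real numbers: its integrals have to be finite for every \<open>u\<close> in
  \<open>Lip_c\<close>. With integrals in \<open>[0, \<infinity>]\<close> and \<open>\<infinity> \<ge> \<infinity>\<close> accepted, the equivalence with the volume cone
  property would fail: on the real line with Lebesgue measure, \<open>x0 = 0\<close>, \<open>q = 3/2\<close> and
  \<open>2 < p < 5/2\<close>, both weighted integrals are infinite whenever \<open>u 0 \<noteq> 0\<close>, and for \<open>u 0 = 0\<close> the
  sharp constant is \<open>((p + 1 - q) / p)\<^sup>2\<close>, which is the constant for \<open>N = p + 1\<close>.
\<close>

definition CKN_integrals_finite ::
    "'a::metric_space measure \<Rightarrow> real \<Rightarrow> real \<Rightarrow> 'a \<Rightarrow> bool" where
  "CKN_integrals_finite m p q x0 \<longleftrightarrow>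
     (\<forall>u\<in>Lip_c.
        (\<integral>\<^sup>+ x. (loc_lip u x)\<^sup>2 \<partial>m) < \<infinity> \<and>
        (\<integral>\<^sup>+ x. epowr \<bar>u x\<bar> (2 * p - 2) / epowr (dist x0 x) (2 * q - 2) \<partial>m) < \<infinity> \<and>
        (\<integral>\<^sup>+ x. epowr \<bar>u x\<bar> p / epowr (dist x0 x) q \<partial>m) < \<infinity>)"

definition CKN_inequality ::
    "'a::metric_space measure \<Rightarrow> real \<Rightarrow> real \<Rightarrow> 'a \<Rightarrow> real \<Rightarrow> bool" where
  "CKN_inequality m p q x0 C \<longleftrightarrow>
     (\<forall>u\<in>Lip_c.
        (\<integral>\<^sup>+ x. (loc_lip u x)\<^sup>2 \<partial>m) *
        (\<integral>\<^sup>+ x. epowr \<bar>u x\<bar> (2 * p - 2) / epowr (dist x0 x) (2 * q - 2) \<partial>m)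
        \<ge> ennreal C * (\<integral>\<^sup>+ x. epowr \<bar>u x\<bar> p / epowr (dist x0 x) q \<partial>m)\<^sup>2)"

definition sharp_constant :: "(real \<Rightarrow> bool) \<Rightarrow> real \<Rightarrow> bool" where
  "sharp_constant P C \<longleftrightarrow> (\<forall>C'>C. \<not> P C')"

definition volume_cone :: "'a::metric_space measure \<Rightarrow> real \<Rightarrow> bool" where
  "volume_cone m N \<longleftrightarrow>
     (\<exists>x0. \<forall>r R. 0 < r \<and> r < R \<longrightarrow>
        measure m (ball x0 R) / measure m (ball x0 r) = (R / r) powr N)"

end

theory Submission
  imports Defs "HOL-Real_Asymp.Real_Asymp"
begin

text \<open>
  Let \<open>d\<close> be the distance from the vertex \<open>x0\<close>. Everything rests on one consequence of
  \<open>MCP(0,N)\<close>. Transporting the uniform measure of a large ball to the Dirac mass at \<open>x0\<close> moves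
  a point at distance \<open>r\<close> to distance \<open>s * r\<close> at time \<open>1 - s\<close>, and the transported measure, weighted
  by \<open>s powr N\<close>, stays below \<open>m\<close>. Hence for every Borel function \<open>\<phi> \<ge> 0\<close> and
  \<open>0 < s \<le> 1\<close>, the integral of \<open>\<phi> (s * d)\<close> times \<open>s powr N\<close> is at most the integral of \<open>\<phi> d\<close>
  (\<open>radial_contraction\<close>). Applied to indicators of intervals this is the Bishop--Gromov inequality,
  which makes closed balls compact and so provides test functions.

  From the inequality to the cone. The functions \<open>(l + d powr (2 - q)) powr (- 1 / (p - 2))\<close> with
  \<open>l > 0\<close> are the extremals on a cone. Let \<open>F l\<close> be the weighted \<open>p\<close>-mass of such a
  function, the integral on the right-hand side. Both integrals on the left-hand side are multiples
  of one integral \<open>G l\<close>, and \<open>F l = G l + l * E l\<close>, where \<open>- p / (p - 2) * E\<close> is formally the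
  derivative of \<open>F\<close>. So the inequality with constant \<open>C\<close>, tested on truncations of the extremals,
  becomes a differential inequality for \<open>F\<close>, and this integrates to
  \<open>F 1 \<le> l powr a * F l\<close> for \<open>l > 1\<close> with \<open>a = p / (p - 2) - p * sqrt C / (2 - q)\<close>
  (\<open>CKN_mass_growth\<close>). Radial contraction gives the opposite inequality
  \<open>l powr \<alpha> * F l \<le> F 1\<close> with \<open>\<alpha> = p / (p - 2) - (N - q) / (2 - q)\<close> (\<open>mass_contraction\<close>).
  The two are incompatible when \<open>a < \<alpha>\<close>, so no constant above \<open>(N - q)\<^sup>2 / p\<^sup>2\<close> is
  possible (\<open>CKN_constant_upper_bound\<close>). When \<open>a = \<alpha>\<close>, radial contraction is an equality for the
  positive integrable density of \<open>F 1\<close>. It is then an equality for every nonnegative function dominated by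
  a multiple of this density, because it is an inequality both for such a function and for its
  complement (\<open>scaling_equality_dominated\<close>). Indicators of intervals are
  dominated, and for them the equality is the cone property (\<open>CKN_imp_ball_scaling\<close>).

  From the cone to the inequality. On a cone the transported ball of radius \<open>R\<close>, weighted by
  \<open>s powr N\<close>, has exactly the mass of the ball of radius \<open>s * R\<close>. A measure that lies below
  another one of the same finite total mass equals it, so the transport becomes an exact change of variables
  (\<open>cone_plan_transport\<close>). It replaces integration by parts along the rays: comparing \<open>\<bar>u\<bar> powr p\<close>
  at the two ends of the geodesics from time \<open>0\<close> to \<open>1 - s\<close>, using convexity of the power and the
  Cauchy--Schwarz inequality, gives a discrete form of the inequality (\<open>plan_inequality\<close>). As \<open>s\<close> tends to \<open>1\<close> its
  constant tends to \<open>(N - q)\<^sup>2 / p\<^sup>2\<close>, and by the reverse Fatou lemma the difference quotients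
  are bounded by \<open>loc_lip u\<close> (\<open>cone_CKN_inequality\<close>).
\<close>

section \<open>Contraction of the reference measure towards a point\<close>

lemma space_Geo_borel: "space Geo_borel = Geo"
  unfolding Geo_borel_def
  by (rule space_measure_of) (auto dest!: openin_subset)

text \<open>
  Evaluation is 1-Lipschitz for the sup distance; openness of preimages is checked on balls.
\<close>
lemma measurable_evaluation:
  assumes t: "t \<in> {0..1}"
  shows "(\<lambda>\<gamma>. \<gamma> t) \<in> Geo_borel \<rightarrow>\<^sub>M (borel :: 'a::metric_space measure)"
proof (rule borel_measurableI)
  fix S :: "'a set" assume S: "open S"
  interpret C: Metric_space "mspace (C01 :: (real \<Rightarrow> 'a) metric)" "mdist C01"
    by (rule Metric_space_mspace_mdist)
  let ?U = "{\<gamma> \<in> mspace (C01 :: (real \<Rightarrow> 'a) metric). \<gamma> t \<in> S}"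
  have "openin C.mtopology ?U"
    unfolding C.openin_mtopology
  proof (intro conjI ballI allI impI)
    fix \<gamma> assume \<gamma>: "\<gamma> \<in> ?U"
    then obtain e where e: "e > 0" "ball (\<gamma> t) e \<subseteq> S"
      using S open_contains_ball by blast
    have "C.mball \<gamma> e \<subseteq> ?U"
    proof
      fix \<eta> assume "\<eta> \<in> C.mball \<gamma> e"
      then have *: "\<eta> \<in> mspace C01" "\<gamma> \<in> mspace C01" "mdist C01 \<gamma> \<eta> < e"
        by (simp_all only: C.in_mball)
      have "mdist euclidean_metric (\<gamma> t) (\<eta> t) \<le> mdist C01 \<gamma> \<eta>"
        by (rule mdist_cfunspace_imp_mdist_le[OF *(2,1)]) (use t in auto)
      then have "dist (\<gamma> t) (\<eta> t) < e" using * by simp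
      then show "\<eta> \<in> ?U" using e * by (auto simp: subset_iff)
    qed
    then show "\<exists>r>0. C.mball \<gamma> r \<subseteq> ?U" using e by blast
  qed auto
  then have "openin (subtopology (mtopology_of C01) Geo) ((\<lambda>\<gamma>. \<gamma> t) -` S \<inter> Geo)"
    unfolding openin_subtopology mtopology_of_def by (auto intro!: exI[of _ ?U] simp: Geo_def)
  then show "(\<lambda>\<gamma>. \<gamma> t) -` S \<inter> space Geo_borel \<in> sets Geo_borel"
    unfolding space_Geo_borel unfolding Geo_borel_def
    by (subst sets_measure_of) (auto dest!: openin_subset intro!: sigma_sets.Basic)
qed

lemma metric_measure_space_sets: "metric_measure_space m \<Longrightarrow> sets m = sets borel"
  by (auto simp: metric_measure_space_def radon_measure_def)

lemma emeasure_ball_pos_finite: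
  assumes "metric_measure_space m" "0 < R"
  shows "0 < emeasure m (ball x R)" "emeasure m (ball x R) < \<infinity>"
  using assms by (auto simp: metric_measure_space_def)

lemma uniform_measure_ball_borel_probs2:
  fixes m :: "'a::polish_space measure"
  assumes m: "metric_measure_space m" and R: "0 < R"
  shows "uniform_measure m (ball x R) \<in> borel_probs2"
proof -
  note [simp] = metric_measure_space_sets[OF m]
  note [measurable_cong] = metric_measure_space_sets[OF m]
  have p: "prob_space (uniform_measure m (ball x R))"
    using emeasure_ball_pos_finite[OF m R, of x] by (intro prob_space_uniform_measure) auto
  interpret prob_space "uniform_measure m (ball x R)" by (rule p)
  have "(\<integral>\<^sup>+ y. ennreal ((dist x y)\<^sup>2) \<partial>uniform_measure m (ball x R))
      \<le> (\<integral>\<^sup>+ y. ennreal (R\<^sup>2) \<partial>uniform_measure m (ball x R))"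
  proof (rule nn_integral_mono_AE, rule AE_uniform_measureI)
    show "AE y in m. y \<in> ball x R \<longrightarrow> ennreal ((dist x y)\<^sup>2) \<le> ennreal (R\<^sup>2)"
      using R by (auto intro!: AE_I2 ennreal_leI power_mono)
  qed simp
  also have "\<dots> < \<infinity>" by (subst nn_integral_const, subst emeasure_space_1) simp
  finally show ?thesis
    unfolding borel_probs2_def borel_probs_def using p by (auto intro!: exI[of _ x])
qed

lemma Geo_evaluations_to_endpoint:
  assumes "\<gamma> \<in> Geo" "\<gamma> 1 = y" "s \<in> {0..1}"
  shows "dist y (\<gamma> (1 - s)) = s * dist y (\<gamma> 0)"
    and "dist (\<gamma> 0) (\<gamma> (1 - s)) = (1 - s) * dist y (\<gamma> 0)"
proof -
  have *: "dist (\<gamma> a) (\<gamma> b) = \<bar>a - b\<bar> * dist (\<gamma> 0) (\<gamma> 1)" if "a \<in> {0..1}" "b \<in> {0..1}" for a b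
    using assms(1) that unfolding Geo_def by blast
  show "dist y (\<gamma> (1 - s)) = s * dist y (\<gamma> 0)"
    using *[of 1 "1 - s"] assms by (auto simp: dist_commute)
  show "dist (\<gamma> 0) (\<gamma> (1 - s)) = (1 - s) * dist y (\<gamma> 0)"
    using *[of 0 "1 - s"] assms by (auto simp: dist_commute)
qed

text \<open>
  The plan given by \<open>MCP(0,N)\<close> is multiplied by the mass of the ball. Then it starts from the
  restriction of \<open>m\<close> to the ball itself, and the density bound reads as an inequality between
  integrals, with no reference to couplings or optimality.
\<close>
lemma MCP0_plan:
  fixes m :: "'a::polish_space measure"
  assumes m: "metric_measure_space m" and mcp: "MCP0 m N" and R: "0 < R"
  obtains \<pi> :: "(real \<Rightarrow> 'a) measure" where
    "sets \<pi> = sets Geo_borel"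
    "AE \<gamma> in \<pi>. \<gamma> 1 = y"
    "\<And>f. f \<in> borel_measurable borel \<Longrightarrow>
       (\<integral>\<^sup>+\<gamma>. f (\<gamma> 0) \<partial>\<pi>) = (\<integral>\<^sup>+x. f x * indicator (ball y R) x \<partial>m)"
    "\<And>f s. f \<in> borel_measurable borel \<Longrightarrow> 0 < s \<Longrightarrow> s \<le> 1 \<Longrightarrow>
       ennreal (s powr N) * (\<integral>\<^sup>+\<gamma>. f (\<gamma> (1 - s)) \<partial>\<pi>) \<le> (\<integral>\<^sup>+x. f x \<partial>m)"
proof -
  let ?A = "ball y R"
  note [simp] = metric_measure_space_sets[OF m]
  note [measurable_cong] = metric_measure_space_sets[OF m]
  have A: "emeasure m ?A \<noteq> 0" "emeasure m ?A \<noteq> \<infinity>"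
    using emeasure_ball_pos_finite[OF m R, of y] by auto
  obtain \<nu> where \<nu>: "\<nu> \<in> OptGeo (uniform_measure m ?A) (return borel y)"
    and le: "\<And>t B. t \<in> {0..1} \<Longrightarrow> B \<in> sets borel \<Longrightarrow>
      emeasure (distr (scale_measure (ennreal ((1 - t) powr N)) \<nu>) borel (\<lambda>\<gamma>. \<gamma> t)) B
        \<le> emeasure (scale_measure (1 / emeasure m ?A) m) B"
    using mcp emeasure_ball_pos_finite[OF m R, of y] uniform_measure_ball_borel_probs2[OF m R, of y]
    unfolding MCP0_def by (metis borel_open open_ball)
  have [measurable_cong, simp]: "sets \<nu> = sets Geo_borel" using \<nu> by (auto simp: OptGeo_def)
  have ev: "(\<lambda>\<gamma>. \<gamma> t) \<in> borel_measurable \<nu>" if "t \<in> {0..1}" for t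
    using measurable_evaluation[OF that] by (simp cong: measurable_cong_sets)
  have ev01: "(\<lambda>\<gamma>. \<gamma> 0) \<in> borel_measurable \<nu>" "(\<lambda>\<gamma>. \<gamma> 1) \<in> borel_measurable \<nu>"
    using ev by simp_all
  have pair: "(\<lambda>\<gamma>. (\<gamma> 0, \<gamma> 1)) \<in> borel_measurable \<nu>"
    by (rule borel_measurable_Pair[OF ev01])
  define c where "c = emeasure m ?A"
  have c: "c \<noteq> 0" "c \<noteq> \<infinity>" "c \<noteq> \<top>" using A by (auto simp: c_def)
  have coup: "distr (distr \<nu> borel (\<lambda>\<gamma>. (\<gamma> 0, \<gamma> 1))) borel fst = uniform_measure m ?A"
      "distr (distr \<nu> borel (\<lambda>\<gamma>. (\<gamma> 0, \<gamma> 1))) borel snd = return borel y"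
    using \<nu> by (auto simp: OptGeo_def couplings_def)
  have fs: "fst \<in> borel_measurable (borel :: ('a \<times> 'a) measure)"
      "snd \<in> borel_measurable (borel :: ('a \<times> 'a) measure)"
    by (auto intro!: borel_measurable_continuous_onI continuous_intros)
  have d0: "distr \<nu> borel (\<lambda>\<gamma>. \<gamma> 0) = uniform_measure m ?A"
    using coup(1) by (subst (asm) distr_distr[OF fs(1) pair]) (simp add: o_def)
  have d1: "distr \<nu> borel (\<lambda>\<gamma>. \<gamma> 1) = return borel y"
    using coup(2) by (subst (asm) distr_distr[OF fs(2) pair]) (simp add: o_def)
  have "AE x in return borel y. x = y" by (subst AE_return) auto
  then have end1: "AE \<gamma> in \<nu>. \<gamma> 1 = y"
    unfolding d1[symmetric] by (subst (asm) AE_distr_iff) (auto simp: ev01)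
  show ?thesis
  proof (rule that[of "scale_measure c \<nu>"])
    show "sets (scale_measure c \<nu>) = sets Geo_borel" by simp
    obtain Z where "{\<gamma> \<in> space \<nu>. \<not> \<gamma> 1 = y} \<subseteq> Z" "emeasure \<nu> Z = 0" "Z \<in> sets \<nu>"
      using end1 by (rule AE_E)
    then show "AE \<gamma> in scale_measure c \<nu>. \<gamma> 1 = y"
      by (intro AE_I[where N = Z]) (simp_all add: space_scale_measure del: \<open>sets \<nu> = sets Geo_borel\<close>)
    fix f :: "'a \<Rightarrow> ennreal" assume f [measurable]: "f \<in> borel_measurable borel"
    have [measurable]: "f \<in> borel_measurable m" using f by (simp cong: measurable_cong_sets)
    have "(\<integral>\<^sup>+\<gamma>. f (\<gamma> 0) \<partial>scale_measure c \<nu>) = c * (\<integral>\<^sup>+x. f x \<partial>distr \<nu> borel (\<lambda>\<gamma>. \<gamma> 0))"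
      using ev01 measurable_compose[OF ev01(1) f]
      by (simp add: nn_integral_scale_measure nn_integral_distr)
    also have "\<dots> = c * ((\<integral>\<^sup>+x. f x * indicator ?A x \<partial>m) / c)"
      unfolding d0 by (subst nn_integral_uniform_measure) (auto simp: c_def)
    also have "\<dots> = (\<integral>\<^sup>+x. f x * indicator ?A x \<partial>m)"
      using c by (metis ennreal_mult_divide_eq ennreal_times_divide mult.commute)
    finally show "(\<integral>\<^sup>+\<gamma>. f (\<gamma> 0) \<partial>scale_measure c \<nu>) = (\<integral>\<^sup>+x. f x * indicator ?A x \<partial>m)" .
    fix s :: real assume s: "0 < s" "s \<le> 1"
    define \<rho> where "\<rho> = distr (scale_measure (ennreal (s powr N)) \<nu>) borel (\<lambda>\<gamma>. \<gamma> (1 - s))"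
    have evs: "(\<lambda>\<gamma>. \<gamma> (1 - s)) \<in> borel_measurable \<nu>" using s by (intro ev) auto
    have "nn_integral \<rho> f \<le> nn_integral (scale_measure (1 / c) m) f"
    proof (rule nn_integral_mono_measure)
      show "sets \<rho> = sets (scale_measure (1 / c) m)" by (simp add: \<rho>_def)
      then show "\<rho> \<le> scale_measure (1 / c) m"
        unfolding le_measure_iff using le[of "1 - s"] s
        by (auto simp: \<rho>_def c_def le_fun_def sets_eq_imp_space_eq)
           (metis emeasure_notin_sets le_zero_eq sets_distr sets_scale_measure
              metric_measure_space_sets[OF m] zero_le)
    qed
    also have "nn_integral \<rho> f = ennreal (s powr N) * (\<integral>\<^sup>+\<gamma>. f (\<gamma> (1 - s)) \<partial>\<nu>)"
      unfolding \<rho>_def using evs measurable_compose[OF evs f]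
      by (subst nn_integral_distr) (auto simp: nn_integral_scale_measure)
    also have "nn_integral (scale_measure (1 / c) m) f = (1 / c) * nn_integral m f"
      by (auto simp: nn_integral_scale_measure)
    finally have "c * (ennreal (s powr N) * (\<integral>\<^sup>+\<gamma>. f (\<gamma> (1 - s)) \<partial>\<nu>)) \<le> c * ((1 / c) * nn_integral m f)"
      by (rule mult_left_mono) simp
    also have "\<dots> = nn_integral m f"
      using c by (metis divide_ennreal_def ennreal_divide_self less_top mult.assoc mult.left_neutral)
    finally show "ennreal (s powr N) * (\<integral>\<^sup>+\<gamma>. f (\<gamma> (1 - s)) \<partial>scale_measure c \<nu>) \<le> (\<integral>\<^sup>+x. f x \<partial>m)"
      using measurable_compose[OF evs f] by (simp add: nn_integral_scale_measure mult_ac)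
  qed
qed

locale mcp_space =
  fixes m :: "'a::polish_space measure" and N :: real
  assumes mms: "metric_measure_space m" and mcp: "MCP0 m N" and N_pos: "0 < N"
begin

lemma sets_m [simp, measurable_cong]: "sets m = sets borel"
  by (rule metric_measure_space_sets[OF mms])

lemma space_m [simp]: "space m = UNIV"
  using sets_eq_imp_space_eq[OF sets_m] by simp

lemma borel_measurable_m: "f \<in> borel_measurable borel \<Longrightarrow> f \<in> borel_measurable m"
  by measurable

text \<open>
  The properties of a dynamical transport of the ball of radius \<open>R\<close> to its centre that are needed
  below. Time is written as \<open>1 - s\<close>, so that \<open>s\<close> is the factor by which distances to the centre shrink.
\<close>
definition contraction_plan :: "'a \<Rightarrow> real \<Rightarrow> (real \<Rightarrow> 'a) measure \<Rightarrow> bool" where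
  "contraction_plan y R \<pi> \<longleftrightarrow> sets \<pi> = sets Geo_borel \<and> (AE \<gamma> in \<pi>. \<gamma> 1 = y) \<and>
    (\<forall>f\<in>borel_measurable borel.
       (\<integral>\<^sup>+\<gamma>. f (\<gamma> 0) \<partial>\<pi>) = (\<integral>\<^sup>+x. f x * indicator (ball y R) x \<partial>m)) \<and>
    (\<forall>f\<in>borel_measurable borel. \<forall>s\<in>{0<..1}.
       ennreal (s powr N) * (\<integral>\<^sup>+\<gamma>. f (\<gamma> (1 - s)) \<partial>\<pi>) \<le> (\<integral>\<^sup>+x. f x \<partial>m))"

lemma contraction_plan_exists:
  assumes "0 < R"
  obtains \<pi> where "contraction_plan y R \<pi>"
proof (rule MCP0_plan[OF mms mcp assms, of y])
qed (rule that, unfold contraction_plan_def, (rule conjI, assumption)+, simp)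

lemma contraction_plan_measurable:
  assumes "contraction_plan y R \<pi>" "t \<in> {0..1}"
  shows "(\<lambda>\<gamma>. \<gamma> t) \<in> borel_measurable \<pi>"
  using measurable_evaluation[OF assms(2)] assms(1)
  by (simp add: contraction_plan_def cong: measurable_cong_sets)

lemma contraction_plan_AE:
  assumes \<pi>: "contraction_plan y R \<pi>" and s: "s \<in> {0..1}"
  shows "AE \<gamma> in \<pi>. dist y (\<gamma> (1 - s)) = s * dist y (\<gamma> 0) \<and>
    dist (\<gamma> 0) (\<gamma> (1 - s)) = (1 - s) * dist y (\<gamma> 0)"
proof -
  have \<pi>: "sets \<pi> = sets Geo_borel" "AE \<gamma> in \<pi>. \<gamma> 1 = y"
    using \<pi> by (auto simp: contraction_plan_def)
  have "AE \<gamma> in \<pi>. \<gamma> \<in> Geo"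
    using AE_space[of \<pi>] sets_eq_imp_space_eq[OF \<pi>(1)] by (simp add: space_Geo_borel)
  then show ?thesis
    using \<pi>(2) by eventually_elim (use Geo_evaluations_to_endpoint s in blast)
qed

lemma contraction_plan_start:
  assumes "contraction_plan y R \<pi>" "f \<in> borel_measurable borel"
  shows "(\<integral>\<^sup>+\<gamma>. f (\<gamma> 0) \<partial>\<pi>) = (\<integral>\<^sup>+x. f x * indicator (ball y R) x \<partial>m)"
  using assms by (simp add: contraction_plan_def)

lemma contraction_plan_le:
  assumes "contraction_plan y R \<pi>" "f \<in> borel_measurable borel" "0 < s" "s \<le> 1"
  shows "ennreal (s powr N) * (\<integral>\<^sup>+\<gamma>. f (\<gamma> (1 - s)) \<partial>\<pi>) \<le> (\<integral>\<^sup>+x. f x \<partial>m)"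
  using assms by (simp add: contraction_plan_def)

lemma nn_integral_eq_SUP_balls:
  assumes [measurable]: "f \<in> borel_measurable borel"
  shows "(\<integral>\<^sup>+x. f x \<partial>m) = (SUP n. \<integral>\<^sup>+x. f x * indicator (ball y (real (Suc n))) x \<partial>m)"
proof -
  have "(\<integral>\<^sup>+x. f x \<partial>m) = (\<integral>\<^sup>+x. (SUP n. f x * indicator (ball y (real (Suc n))) x) \<partial>m)"
  proof (rule nn_integral_cong)
    fix x
    obtain n where "dist y x < real (Suc n)" using reals_Archimedean2[of "dist y x"]
      by (metis less_Suc_eq of_nat_less_iff order_less_trans)
    then show "f x = (SUP n. f x * indicator (ball y (real (Suc n))) x)"
      by (intro antisym SUP_upper2[of n] SUP_least) (auto split: split_indicator)
  qed
  also have "\<dots> = (SUP n. \<integral>\<^sup>+x. f x * indicator (ball y (real (Suc n))) x \<partial>m)"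
    by (rule nn_integral_monotone_convergence_SUP)
       (auto simp: incseq_def le_fun_def split: split_indicator
         intro!: borel_measurable_times_ennreal borel_measurable_indicator borel_measurable_m)
  finally show ?thesis .
qed

text \<open>
  A function of the distance to the centre takes the same value at \<open>\<gamma> (1 - s)\<close> as its
  rescaling by \<open>s\<close> takes at \<open>\<gamma> 0\<close>, so the bound for the transported measure involves no trace of
  the plan.
\<close>
lemma radial_contraction:
  fixes \<phi> :: "real \<Rightarrow> ennreal"
  assumes [measurable]: "\<phi> \<in> borel_measurable borel" and s: "0 < s" "s \<le> 1"
  shows "ennreal (s powr N) * (\<integral>\<^sup>+x. \<phi> (s * dist y x) \<partial>m) \<le> (\<integral>\<^sup>+x. \<phi> (dist y x) \<partial>m)"
proof -
  have "ennreal (s powr N) * (\<integral>\<^sup>+x. \<phi> (s * dist y x) * indicator (ball y (real (Suc n))) x \<partial>m)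
      \<le> (\<integral>\<^sup>+x. \<phi> (dist y x) \<partial>m)" for n
  proof -
    obtain \<pi> where \<pi>: "contraction_plan y (real (Suc n)) \<pi>"
      using contraction_plan_exists[of "real (Suc n)" y] by auto
    have "(\<integral>\<^sup>+x. \<phi> (s * dist y x) * indicator (ball y (real (Suc n))) x \<partial>m)
        = (\<integral>\<^sup>+\<gamma>. \<phi> (s * dist y (\<gamma> 0)) \<partial>\<pi>)"
      by (rule contraction_plan_start[OF \<pi>, symmetric]) measurable
    also have "\<dots> = (\<integral>\<^sup>+\<gamma>. \<phi> (dist y (\<gamma> (1 - s))) \<partial>\<pi>)"
      using contraction_plan_AE[OF \<pi>, of s] s
      by (intro nn_integral_cong_AE) (auto elim!: eventually_mono)
    finally show ?thesis using contraction_plan_le[OF \<pi>, of "\<lambda>x. \<phi> (dist y x)" s] s by simp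
  qed
  then have "(SUP n. ennreal (s powr N) *
      (\<integral>\<^sup>+x. \<phi> (s * dist y x) * indicator (ball y (real (Suc n))) x \<partial>m)) \<le> (\<integral>\<^sup>+x. \<phi> (dist y x) \<partial>m)"
    by (rule SUP_least)
  then show ?thesis
    by (subst nn_integral_eq_SUP_balls[where y = y]) (simp_all add: SUP_mult_left_ennreal)
qed

end

section \<open>Volume growth and compactness of balls\<close>

context mcp_space
begin

lemma bishop_gromov:
  assumes "0 < r" "r \<le> R"
  shows "emeasure m (ball y R) \<le> ennreal ((R / r) powr N) * emeasure m (ball y r)"
proof -
  have i: "(\<integral>\<^sup>+x. indicator {..<r} (s * dist y x) \<partial>m) = emeasure m (ball y (r / s))" if "0 < s" for s
  proof -
    have "(\<integral>\<^sup>+x. indicator {..<r} (s * dist y x) \<partial>m) = (\<integral>\<^sup>+x. indicator (ball y (r / s)) x \<partial>m)"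
      using that by (intro nn_integral_cong) (auto simp: field_simps split: split_indicator)
    then show ?thesis by simp
  qed
  have "ennreal ((r / R) powr N) * emeasure m (ball y R) \<le> emeasure m (ball y r)"
    using radial_contraction[of "indicator {..<r}" "r / R" y] i[of "r / R"] i[of 1] assms by auto
  then have "ennreal ((R / r) powr N) * (ennreal ((r / R) powr N) * emeasure m (ball y R))
      \<le> ennreal ((R / r) powr N) * emeasure m (ball y r)"
    by (rule mult_left_mono) simp
  moreover have "(R / r) powr N * (r / R) powr N = 1"
    using assms by (simp add: powr_mult[symmetric])
  ultimately show ?thesis by (simp add: mult.assoc[symmetric] ennreal_mult[symmetric])
qed

text \<open>
  The standard packing argument: disjoint balls of radius \<open>e / 2\<close> inside one ball, each carrying a
  fixed fraction of its volume by Bishop--Gromov.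
\<close>
lemma separated_card_bound:
  fixes x :: 'a
  assumes e: "0 < e" and R: "0 \<le> R" and fin: "finite S" and S: "S \<subseteq> cball x R"
    and sep: "\<And>y z. y \<in> S \<Longrightarrow> z \<in> S \<Longrightarrow> y \<noteq> z \<Longrightarrow> e \<le> dist y z"
  shows "real (card S) \<le> ((2 * R + 2 * e) / (e / 2)) powr N"
proof -
  let ?K = "((2 * R + 2 * e) / (e / 2)) powr N" and ?V = "emeasure m (ball x (R + e))"
  have V: "?V \<noteq> 0" "?V \<noteq> \<infinity>"
    using emeasure_ball_pos_finite[OF mms, of "R + e" x] e R by auto
  have le: "?V \<le> ennreal ?K * emeasure m (ball y (e / 2))" if "y \<in> S" for y
  proof -
    have "ball x (R + e) \<subseteq> ball y (2 * R + 2 * e)"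
    proof
      fix z assume z: "z \<in> ball x (R + e)"
      have "dist x y \<le> R" using S that by auto
      with z e show "z \<in> ball y (2 * R + 2 * e)"
        using dist_triangle[of y z x] by (auto simp: dist_commute)
    qed
    then have "?V \<le> emeasure m (ball y (2 * R + 2 * e))" by (intro emeasure_mono) auto
    also have "\<dots> \<le> ennreal ?K * emeasure m (ball y (e / 2))"
      by (rule bishop_gromov) (use e R in auto)
    finally show ?thesis .
  qed
  have disj: "disjoint_family_on (\<lambda>y. ball y (e / 2)) S"
    unfolding disjoint_family_on_def
  proof (intro ballI impI)
    fix y z assume "y \<in> S" "z \<in> S" "y \<noteq> z"
    then have "e \<le> dist y z" by (rule sep)
    then show "ball y (e / 2) \<inter> ball z (e / 2) = {}"
      using dist_triangle_half_l[of y _ e z] by (fastforce simp: dist_commute)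
  qed
  have "of_nat (card S) * ?V = (\<Sum>y\<in>S. ?V)" by simp
  also have "\<dots> \<le> (\<Sum>y\<in>S. ennreal ?K * emeasure m (ball y (e / 2)))" by (rule sum_mono) (rule le)
  also have "\<dots> = ennreal ?K * emeasure m (\<Union>y\<in>S. ball y (e / 2))"
    using fin disj by (subst sum_emeasure[symmetric]) (auto simp: sum_distrib_left)
  also have "\<dots> \<le> ennreal ?K * ?V"
  proof (intro mult_left_mono emeasure_mono)
    show "(\<Union>y\<in>S. ball y (e / 2)) \<subseteq> ball x (R + e)"
    proof
      fix z assume "z \<in> (\<Union>y\<in>S. ball y (e / 2))"
      then obtain y where "y \<in> S" "dist y z < e / 2" by auto
      moreover have "dist x y \<le> R" using S \<open>y \<in> S\<close> by auto
      ultimately show "z \<in> ball x (R + e)" using dist_triangle[of x z y] e by auto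
    qed
  qed auto
  finally have "of_nat (card S) * ?V \<le> ennreal ?K * ?V" .
  moreover obtain v where "?V = ennreal v" "0 < v"
    using V by (cases ?V) auto
  ultimately have "ennreal (real (card S) * v) \<le> ennreal (?K * v)"
    by (simp add: ennreal_mult ennreal_of_nat_eq_real_of_nat)
  then have "real (card S) * v \<le> ?K * v"
    using \<open>0 < v\<close> by (subst (asm) ennreal_le_iff) auto
  then show ?thesis using \<open>0 < v\<close> by simp
qed

text \<open>
  A maximal separated set is a finite net, and the space is complete.
\<close>
lemma compact_cball_mcp: "compact (cball (x :: 'a) R)"
proof (cases "0 \<le> R")
  case True
  show ?thesis
    unfolding compact_eq_totally_bounded complete_eq_closed
  proof (intro conjI allI impI)
    show "closed (cball x R)" by simp
    fix e :: real assume e: "0 < e"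
    define P where "P = (\<lambda>S. finite S \<and> S \<subseteq> cball x R \<and>
      (\<forall>y\<in>S. \<forall>z\<in>S. y \<noteq> z \<longrightarrow> e \<le> dist y z))"
    have bd: "card S \<le> nat \<lceil>((2 * R + 2 * e) / (e / 2)) powr N\<rceil>" if "P S" for S
    proof -
      have "real (card S) \<le> ((2 * R + 2 * e) / (e / 2)) powr N"
        using that e True by (intro separated_card_bound) (auto simp: P_def)
      then show ?thesis by linarith
    qed
    have "P {}" by (simp add: P_def)
    then obtain S where S: "P S" "\<And>T. P T \<Longrightarrow> card T \<le> card S"
      using ex_has_greatest_nat[of P "{}" card] bd by (metis le_imp_less_Suc)
    \<comment> \<open>A point not covered could be added to the separated set of greatest cardinality.\<close>
    have "cball x R \<subseteq> (\<Union>y\<in>S. ball y e)"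
    proof (rule ccontr)
      assume "\<not> ?thesis"
      then obtain z where z: "z \<in> cball x R" "z \<notin> (\<Union>y\<in>S. ball y e)" by blast
      then have z: "z \<in> cball x R" "\<And>y. y \<in> S \<Longrightarrow> e \<le> dist y z" by (auto simp: not_less)
      then have "z \<notin> S" using e by force
      moreover have "P (insert z S)" using S(1) z by (auto simp: P_def dist_commute)
      ultimately show False using S(2)[of "insert z S"] S(1) by (auto simp: P_def)
    qed
    then show "\<exists>k. finite k \<and> cball x R \<subseteq> (\<Union>y\<in>k. ball y e)" using S(1) by (auto simp: P_def)
  qed
qed (simp add: not_le cball_empty)

end

section \<open>Local Lipschitz constants\<close>

text \<open>
  A chain rule stated for any function that oscillates at \<open>x\<close> no more than \<open>h\<close> does, so that it
  covers truncations of radial functions as well.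
\<close>
lemma loc_lip_le_radial:
  fixes u :: "'a::metric_space \<Rightarrow> real"
  assumes D: "(h has_real_derivative D) (at (dist x0 x))"
    and u: "\<And>y. \<bar>u y - u x\<bar> \<le> \<bar>h (dist x0 y) - h (dist x0 x)\<bar>"
  shows "loc_lip u x \<le> ennreal \<bar>D\<bar>"
proof (rule ennreal_le_epsilon)
  fix e :: real assume e: "0 < e"
  let ?r = "dist x0 x"
  have "((\<lambda>s. \<bar>(h s - h ?r) / (s - ?r)\<bar>) \<longlongrightarrow> \<bar>D\<bar>) (at ?r)"
    using D by (intro tendsto_rabs) (simp add: has_field_derivative_iff)
  then have "\<forall>\<^sub>F s in at ?r. \<bar>(h s - h ?r) / (s - ?r)\<bar> < \<bar>D\<bar> + e"
    using e by (intro order_tendstoD) auto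
  then have "\<forall>\<^sub>F s in at ?r. \<bar>h s - h ?r\<bar> \<le> (\<bar>D\<bar> + e) * \<bar>s - ?r\<bar>"
    unfolding eventually_at_filter by eventually_elim (auto simp: abs_divide divide_less_eq)
  then have ev: "\<forall>\<^sub>F s in nhds ?r. \<bar>h s - h ?r\<bar> \<le> (\<bar>D\<bar> + e) * \<bar>s - ?r\<bar>"
    unfolding eventually_at_filter by eventually_elim auto
  have "((\<lambda>y. dist x0 y) \<longlongrightarrow> ?r) (at x)" by (intro tendsto_intros)
  then have "\<forall>\<^sub>F y in at x. \<bar>h (dist x0 y) - h ?r\<bar> \<le> (\<bar>D\<bar> + e) * \<bar>dist x0 y - ?r\<bar>"
    using ev by (rule eventually_compose_filterlim[rotated])
  then have "\<forall>\<^sub>F y in at x. ennreal (\<bar>u y - u x\<bar> / dist x y) \<le> ennreal (\<bar>D\<bar> + e)"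
    unfolding eventually_at_filter
  proof eventually_elim
    case (elim y)
    show ?case
    proof (intro impI)
      assume "y \<noteq> x"
      then have "\<bar>u y - u x\<bar> \<le> (\<bar>D\<bar> + e) * \<bar>dist x0 y - ?r\<bar>" using elim u[of y] by simp
      also have "\<bar>dist x0 y - ?r\<bar> \<le> dist x y"
        using abs_dist_diff_le[of y x0 x] by (simp add: dist_commute)
      finally have "\<bar>u y - u x\<bar> \<le> (\<bar>D\<bar> + e) * dist x y"
        using e by (simp add: mult_left_mono)
      then show "ennreal (\<bar>u y - u x\<bar> / dist x y) \<le> ennreal (\<bar>D\<bar> + e)"
        using \<open>y \<noteq> x\<close> by (intro ennreal_leI) (simp add: divide_le_eq)
    qed
  qed
  then have "loc_lip u x \<le> ennreal (\<bar>D\<bar> + e)"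
    unfolding loc_lip_def by (rule Limsup_bounded)
  then show "loc_lip u x \<le> ennreal \<bar>D\<bar> + ennreal e" using e by (simp add: ennreal_plus)
qed

text \<open>
  For a fixed radius the supremum of the difference quotients is lower semicontinuous: a quotient
  exceeding \<open>c\<close> still does so after a small displacement of \<open>x\<close>. The local Lipschitz constant is the
  infimum of countably many of these suprema.
\<close>
lemma loc_lip_measurable:
  fixes u :: "'a::metric_space \<Rightarrow> real"
  assumes u: "continuous_on UNIV u"
  shows "loc_lip u \<in> borel_measurable borel"
proof -
  define Q where "Q = (\<lambda>x y. ennreal (\<bar>u y - u x\<bar> / dist x y))"
  have eq: "loc_lip u x = (INF n. SUP y\<in>ball x (1 / real (Suc n)) - {x}. Q x y)" for x
  proof -
    have "loc_lip u x = (INF e\<in>{0<..}. SUP y\<in>ball x e - {x}. Q x y)"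
      by (simp add: loc_lip_def Limsup_at Q_def)
    also have "\<dots> = (INF n. SUP y\<in>ball x (1 / real (Suc n)) - {x}. Q x y)"
    proof (rule antisym)
      show "(INF e\<in>{0<..}. SUP y\<in>ball x e - {x}. Q x y) \<le> (INF n. SUP y\<in>ball x (1 / real (Suc n)) - {x}. Q x y)"
        by (intro INF_greatest INF_lower) auto
      show "(INF n. SUP y\<in>ball x (1 / real (Suc n)) - {x}. Q x y) \<le> (INF e\<in>{0<..}. SUP y\<in>ball x e - {x}. Q x y)"
      proof (rule INF_greatest)
        fix e :: real assume "e \<in> {0<..}"
        then obtain n where n: "1 / real (Suc n) < e" using nat_approx_posE by auto
        show "(INF n. SUP y\<in>ball x (1 / real (Suc n)) - {x}. Q x y) \<le> (SUP y\<in>ball x e - {x}. Q x y)"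
          by (rule INF_lower2[of n], simp, rule SUP_subset_mono) (use n in auto)
      qed
    qed
    finally show ?thesis .
  qed
  have "(\<lambda>x. SUP y\<in>ball x e - {x}. Q x y) \<in> borel_measurable borel" for e
  proof (rule borel_measurableI_greater)
    fix c :: ennreal
    have "{x \<in> space borel. c < (SUP y\<in>ball x e - {x}. Q x y)}
        = (\<Union>y. (ball y e - {y}) \<inter> (\<lambda>x. Q x y) -` {c<..})"
      by (auto simp: less_SUP_iff dist_commute)
    also have "open \<dots>"
    proof (rule open_UN, rule ballI)
      fix y
      have "continuous_on (ball y e - {y}) (\<lambda>x. Q x y)"
        unfolding Q_def
        by (intro continuous_intros continuous_on_ennreal continuous_on_subset[OF u]) auto
      then show "open ((ball y e - {y}) \<inter> (\<lambda>x. Q x y) -` {c<..})"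
        by (rule continuous_open_preimage) (auto intro: open_delete)
    qed
    finally show "{x \<in> space borel. c < (SUP y\<in>ball x e - {x}. Q x y)} \<in> sets borel"
      by (rule borel_open)
  qed
  then show ?thesis unfolding eq[abs_def] by (intro borel_measurable_INF) auto
qed

lemma loc_lip_le_lipschitz:
  assumes "L-lipschitz_on UNIV u"
  shows "loc_lip u x \<le> ennreal L"
  unfolding loc_lip_def
proof (rule Limsup_bounded, rule always_eventually, rule allI)
  fix y
  have L: "0 \<le> L" using assms by (rule lipschitz_on_nonneg)
  have "\<bar>u y - u x\<bar> \<le> L * dist x y"
    using lipschitz_onD[OF assms, of y x] by (simp add: dist_real_def dist_commute)
  then show "ennreal (\<bar>u y - u x\<bar> / dist x y) \<le> ennreal L"
    using L by (intro ennreal_leI) (cases "x = y", auto simp: divide_le_eq)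
qed

lemma lipschitz_difference_quotient_square:
  assumes "L-lipschitz_on UNIV u"
  shows "(\<bar>u y - u x\<bar> / dist x y)\<^sup>2 \<le> L\<^sup>2"
proof -
  have "\<bar>u y - u x\<bar> \<le> L * dist x y"
    using lipschitz_onD[OF assms, of y x] by (simp add: dist_real_def dist_commute)
  then have "\<bar>u y - u x\<bar> / dist x y \<le> L"
    using lipschitz_on_nonneg[OF assms] by (cases "x = y") (auto simp: divide_le_eq)
  then show ?thesis by (intro power_mono) auto
qed

lemma loc_lip_eq_0_outside_support:
  assumes "x \<notin> closure {x. u x \<noteq> 0}"
  shows "loc_lip u x = 0"
proof -
  have off: "\<forall>\<^sub>F y in nhds x. y \<in> - closure {x. u x \<noteq> 0}"
    using assms by (intro eventually_nhds_in_open) auto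
  have out: "u y = 0" if "y \<notin> closure {x. u x \<noteq> 0}" for y
    using subsetD[OF closure_subset[of "{x. u x \<noteq> 0}"], of y] that by blast
  have "\<forall>\<^sub>F y in nhds x. u y = 0"
    using off by (rule eventually_mono) (intro out, erule ComplD)
  moreover have "u x = 0" using assms by (rule out)
  ultimately have "\<forall>\<^sub>F y in at x. ennreal (\<bar>u y - u x\<bar> / dist x y) \<le> 0"
    unfolding eventually_at_filter by (auto elim!: eventually_mono)
  then have "loc_lip u x \<le> 0" unfolding loc_lip_def by (rule Limsup_bounded)
  then show ?thesis by simp
qed

text \<open>
  The form in which the reverse Fatou lemma uses the local Lipschitz constant: along a sequence, and squared.
\<close>
lemma limsup_difference_quotient_le_loc_lip:
  assumes u: "L-lipschitz_on UNIV u" and y: "y \<longlonglongrightarrow> x" "\<And>n. y n \<noteq> x"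
  shows "limsup (\<lambda>n. ennreal ((\<bar>u (y n) - u x\<bar> / dist x (y n))\<^sup>2)) \<le> (loc_lip u x)\<^sup>2"
proof -
  obtain l where l: "loc_lip u x = ennreal l" "0 \<le> l"
    using loc_lip_le_lipschitz[OF u, of x] by (cases "loc_lip u x") (auto simp: top_unique)
  have le: "limsup (\<lambda>n. ennreal ((\<bar>u (y n) - u x\<bar> / dist x (y n))\<^sup>2)) \<le> ennreal ((l + 1 / real (Suc k))\<^sup>2)" for k
  proof (rule Limsup_bounded)
    have "loc_lip u x < ennreal (l + 1 / real (Suc k))" using l by (simp add: ennreal_less_iff)
    then have ev: "\<forall>\<^sub>F z in at x. ennreal (\<bar>u z - u x\<bar> / dist x z) < ennreal (l + 1 / real (Suc k))"
      unfolding loc_lip_def by (rule Limsup_lessD)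
    have "filterlim y (at x) sequentially" using y by (simp add: filterlim_at)
    then have "\<forall>\<^sub>F n in sequentially. ennreal (\<bar>u (y n) - u x\<bar> / dist x (y n)) < ennreal (l + 1 / real (Suc k))"
      using ev by (rule eventually_compose_filterlim[rotated])
    then show "\<forall>\<^sub>F n in sequentially. ennreal ((\<bar>u (y n) - u x\<bar> / dist x (y n))\<^sup>2)
      \<le> ennreal ((l + 1 / real (Suc k))\<^sup>2)"
      by eventually_elim (auto simp: ennreal_less_iff intro!: ennreal_leI power_mono)
  qed
  have "(\<lambda>k. ennreal ((l + 1 / real (Suc k))\<^sup>2)) \<longlonglongrightarrow> ennreal ((l + 0)\<^sup>2)"
    by (intro tendsto_ennrealI tendsto_intros LIMSEQ_Suc[OF lim_inverse_n'])
  then have "limsup (\<lambda>n. ennreal ((\<bar>u (y n) - u x\<bar> / dist x (y n))\<^sup>2)) \<le> ennreal ((l + 0)\<^sup>2)"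
    by (rule LIMSEQ_le_const) (use le in blast)
  then show ?thesis using l by (simp add: ennreal_power)
qed

lemma Lip_c_bounds:
  assumes "u \<in> Lip_c"
  obtains L S R where "L-lipschitz_on UNIV u" "0 \<le> S" "\<And>x. \<bar>u x\<bar> \<le> S" "0 < R"
    "\<And>x. R \<le> dist x0 x \<Longrightarrow> u x = 0" "\<And>x. R \<le> dist x0 x \<Longrightarrow> loc_lip u x = 0"
proof -
  let ?K = "closure {x. u x \<noteq> 0}"
  obtain L where L: "L-lipschitz_on UNIV u" and K: "compact ?K"
    using assms by (auto simp: Lip_c_def)
  have "continuous_on UNIV u" using L by (rule lipschitz_on_continuous_on)
  then have "bounded (u ` ?K)"
    using K by (intro compact_imp_bounded compact_continuous_image) (auto intro: continuous_on_subset)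
  then obtain S where S: "0 < S" "\<And>x. x \<in> ?K \<Longrightarrow> \<bar>u x\<bar> \<le> S" by (auto simp: bounded_pos)
  obtain e where e: "\<And>x. x \<in> ?K \<Longrightarrow> dist x0 x \<le> e"
    using compact_imp_bounded[OF K] by (auto simp: bounded_any_center[where a = x0])
  define R where "R = max 1 (e + 1)"
  have out: "x \<notin> ?K" if "R \<le> dist x0 x" for x using e[of x] that by (auto simp: R_def)
  have zero: "u x = 0" if "x \<notin> ?K" for x
    using subsetD[OF closure_subset[of "{x. u x \<noteq> 0}"], of x] that by blast
  show ?thesis
  proof (rule that[OF L])
    show "0 \<le> S" using S by simp
    show "\<bar>u x\<bar> \<le> S" for x using S zero[of x] by (cases "x \<in> ?K") auto
    show "0 < R" by (simp add: R_def)
    show "u x = 0" if "R \<le> dist x0 x" for x by (rule zero[OF out[OF that]])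
    show "loc_lip u x = 0" if "R \<le> dist x0 x" for x
      by (rule loc_lip_eq_0_outside_support[OF out[OF that]])
  qed
qed

section \<open>Inequalities for powers, and a convergence criterion\<close>

text \<open>
  Convexity of \<open>y powr (- b)\<close>, obtained from \<open>exp x \<ge> 1 + x\<close> and \<open>ln x \<le> x - 1\<close>.
\<close>
lemma powr_minus_ge_tangent:
  fixes y z b :: real
  assumes "0 < y" "0 < z" "0 \<le> b"
  shows "z powr (- b) \<le> y powr (- b) + b * (y - z) * z powr (- b - 1)"
proof -
  have "1 - b * (y / z - 1) \<le> 1 - b * ln (y / z)"
    using ln_le_minus_one[of "y / z"] assms by (intro diff_left_mono mult_left_mono) auto
  also have "\<dots> \<le> exp (- b * ln (y / z))" using exp_ge_add_one_self[of "- b * ln (y / z)"] by simp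
  also have "\<dots> = (y / z) powr (- b)" using assms by (simp add: powr_def)
  finally have "z powr (- b) * (1 - b * (y / z - 1)) \<le> z powr (- b) * (y / z) powr (- b)"
    by (rule mult_left_mono) simp
  also have "\<dots> = y powr (- b)" using assms by (simp add: powr_mult[symmetric])
  finally have "z powr (- b) - b * (y - z) * (z powr (- b) / z) \<le> y powr (- b)"
    using assms by (simp add: field_simps)
  moreover have "z powr (- b - 1) = z powr (- b) / z" using assms by (simp add: powr_diff)
  ultimately show ?thesis by simp
qed

lemma powr_diff_le_tangent:
  fixes a b p :: real
  assumes "0 \<le> a" "0 \<le> b" "1 < p"
  shows "a powr p \<le> b powr p + p * a powr (p - 1) * \<bar>a - b\<bar>"
proof (cases "a \<le> b")
  case True
  then have "a powr p \<le> b powr p" using assms by (intro powr_mono2) auto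
  then show ?thesis using assms by (simp add: add_increasing2)
next
  case False
  then have ba: "b < a" by simp
  have "continuous_on {b..a} (\<lambda>x. x powr p)"
    using assms by (intro continuous_on_powr' continuous_intros) auto
  moreover have "((\<lambda>x. x powr p) has_real_derivative p * x powr (p - 1)) (at x)" if "b < x" for x
    using has_real_derivative_powr[of x p] that assms by simp
  ultimately obtain z where z: "b < z" "z < a" "a powr p - b powr p = (a - b) * (p * z powr (p - 1))"
    using MVT[OF ba, of "\<lambda>x. x powr p"] by (metis DERIV_unique real_differentiable_def)
  have "z powr (p - 1) \<le> a powr (p - 1)" using z assms by (intro powr_mono2) auto
  then have "(a - b) * (p * z powr (p - 1)) \<le> (a - b) * (p * a powr (p - 1))"
    using ba assms by (intro mult_left_mono) auto
  then show ?thesis using z ba by (simp add: mult_ac)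
qed

text \<open>
  A discrete Gronwall lemma. The step condition is the first-order form of the conclusion; it is
  iterated along the geometric progression of ratio \<open>r powr (1 / n)\<close> from \<open>1\<close> to \<open>r\<close>, and the error
  disappears as \<open>n\<close> grows.
\<close>
lemma powr_lower_bound_of_infinitesimal:
  fixes f :: "real \<Rightarrow> real"
  assumes pos: "\<And>x. 1 \<le> x \<Longrightarrow> 0 \<le> f x"
    and step: "\<And>x y. 1 \<le> x \<Longrightarrow> x \<le> y \<Longrightarrow> f x * (1 - a * (y / x - 1)) \<le> f y"
    and r: "1 < r"
  shows "f 1 \<le> r powr a * f r"
proof -
  define c where "c = (\<lambda>n::nat. r powr (1 / real n))"
  have c1: "1 \<le> c n" for n using r by (simp add: c_def ge_one_powr_ge_zero)
  have pw: "f 1 * (1 - a * (c n - 1)) ^ j \<le> f (c n ^ j)" if n: "0 \<le> 1 - a * (c n - 1)" for n j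
  proof (induction j)
    case (Suc j)
    have "f 1 * (1 - a * (c n - 1)) ^ Suc j = f 1 * (1 - a * (c n - 1)) ^ j * (1 - a * (c n - 1))"
      by simp
    also have "\<dots> \<le> f (c n ^ j) * (1 - a * (c n - 1))"
      using Suc n by (rule mult_right_mono)
    also have "\<dots> = f (c n ^ j) * (1 - a * (c n ^ Suc j / c n ^ j - 1))"
      using c1[of n] by simp
    also have "\<dots> \<le> f (c n ^ Suc j)"
      using c1[of n] by (intro step one_le_power power_increasing) auto
    finally show ?case .
  qed simp
  have lim: "(\<lambda>n. (1 - a * (c n - 1)) ^ n) \<longlonglongrightarrow> r powr (- a)"
    unfolding c_def powr_def[of r "- a"] using r by (simp, real_asymp)
  have "(\<lambda>n. 1 - a * (c n - 1)) \<longlonglongrightarrow> 1" unfolding c_def using r by real_asymp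
  then have "\<forall>\<^sub>F n in sequentially. 0 < 1 - a * (c n - 1)" by (rule order_tendstoD) simp
  then have "\<forall>\<^sub>F n in sequentially. f 1 * (1 - a * (c n - 1)) ^ n \<le> f r"
    using eventually_gt_at_top[of 0]
  proof eventually_elim
    case (elim n)
    have "c n ^ n = r" using elim r by (simp add: c_def powr_power)
    with pw[of n n] elim show ?case by simp
  qed
  then have "f 1 * r powr (- a) \<le> f r"
    by (intro tendsto_le[OF _ tendsto_const tendsto_mult[OF tendsto_const lim]]) auto
  then have "r powr a * (f 1 * r powr (- a)) \<le> r powr a * f r" by (rule mult_left_mono) simp
  then show ?thesis using r by (simp add: powr_minus field_simps)
qed

lemma epowr_divide:
  assumes "0 \<le> u" "0 < b" "0 < r"
  shows "epowr u b / epowr r a = ennreal (u powr b * r powr (- a))"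
  using assms by (auto simp: epowr_def divide_ennreal powr_minus field_simps)

text \<open>
  Used for powers of the distance on dyadic annuli, both towards the vertex and towards infinity.
\<close>
lemma nn_integral_finite_of_geometric_pieces:
  fixes A :: "nat \<Rightarrow> 'b set" and c :: "nat \<Rightarrow> real"
  assumes [measurable]: "\<And>j. A j \<in> sets M"
    and fc: "\<And>j x. x \<in> A j \<Longrightarrow> f x \<le> ennreal (c j)"
    and geo: "\<And>j. ennreal (c j) * emeasure M (A j) \<le> ennreal (K * \<kappa> ^ j)"
    and K: "0 \<le> K" and \<kappa>: "0 \<le> \<kappa>" "\<kappa> < 1"
  shows "(\<integral>\<^sup>+x. f x * indicator (\<Union>j. A j) x \<partial>M) < \<infinity>"
proof -
  have "(\<integral>\<^sup>+x. f x * indicator (\<Union>j. A j) x \<partial>M) \<le> (\<integral>\<^sup>+x. (\<Sum>j. ennreal (c j) * indicator (A j) x) \<partial>M)"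
  proof (rule nn_integral_mono)
    fix x
    show "f x * indicator (\<Union>j. A j) x \<le> (\<Sum>j. ennreal (c j) * indicator (A j) x)"
    proof (cases "x \<in> (\<Union>j. A j)")
      case True
      then obtain j where j: "x \<in> A j" by auto
      have "f x \<le> (\<Sum>i\<in>{j}. ennreal (c i) * indicator (A i) x)" using fc[OF j] j by simp
      also have "\<dots> \<le> (\<Sum>j. ennreal (c j) * indicator (A j) x)" by (rule sum_le_suminf) auto
      finally show ?thesis using True by simp
    qed simp
  qed
  also have "\<dots> = (\<Sum>j. ennreal (c j) * emeasure M (A j))"
    by (subst nn_integral_suminf) (auto simp: nn_integral_cmult_indicator)
  also have "\<dots> \<le> (\<Sum>j. ennreal (K * \<kappa> ^ j))" by (rule suminf_le) (auto simp: geo)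
  also have "\<dots> = ennreal (\<Sum>j. K * \<kappa> ^ j)"
    using K \<kappa> by (intro suminf_ennreal2 summable_mult summable_geometric) auto
  finally show ?thesis using le_less_trans by fastforce
qed

section \<open>Extremal profiles\<close>

locale ckn_exponents =
  fixes p q :: real
  assumes q_pos: "0 < q" and q_less: "q < 2" and p_gt: "2 < p"
begin

text \<open>
  The extremal functions of the inequality on a cone, as functions of the distance to the vertex:
  they turn the Cauchy--Schwarz inequality behind it into an equality.
\<close>
definition profile :: "real \<Rightarrow> real \<Rightarrow> real" where
  "profile l r = (l + r powr (2 - q)) powr (- 1 / (p - 2))"

definition profile_deriv :: "real \<Rightarrow> real \<Rightarrow> real" where
  "profile_deriv l r =
     - (2 - q) / (p - 2) * (r powr (1 - q) * (l + r powr (2 - q)) powr (- (p - 1) / (p - 2)))"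

text \<open>
  Integrand of the weighted \<open>p\<close>-mass of the profile, see \<open>profile_powr\<close>.
\<close>
definition mass_density :: "real \<Rightarrow> real \<Rightarrow> real" where
  "mass_density l r = r powr (- q) * (l + r powr (2 - q)) powr (- p / (p - 2))"

text \<open>
  Up to a constant, the squared derivative of the profile, and at the same time the other integrand
  on the left-hand side, see \<open>profile_deriv_square\<close> and \<open>profile_powr\<close>.
\<close>
definition energy_density :: "real \<Rightarrow> real \<Rightarrow> real" where
  "energy_density l r = r powr (2 - 2 * q) * (l + r powr (2 - q)) powr (- (2 * p - 2) / (p - 2))"

text \<open>
  Up to the factor \<open>- p / (p - 2)\<close>, the derivative of \<open>mass_density l r\<close> with respect to \<open>l\<close>.
\<close>
definition mass_slope :: "real \<Rightarrow> real \<Rightarrow> real" where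
  "mass_slope l r = r powr (- q) * (l + r powr (2 - q)) powr (- (2 * p - 2) / (p - 2))"

lemma profile_nonneg [simp]: "0 \<le> profile l r"
  and mass_density_nonneg [simp]: "0 \<le> mass_density l r"
  and energy_density_nonneg [simp]: "0 \<le> energy_density l r"
  and mass_slope_nonneg [simp]: "0 \<le> mass_slope l r"
  by (simp_all add: profile_def mass_density_def energy_density_def mass_slope_def)

lemma measurable_densities [measurable]:
  "mass_density l \<in> borel_measurable borel"
  "energy_density l \<in> borel_measurable borel"
  "mass_slope l \<in> borel_measurable borel"
  unfolding mass_density_def[abs_def] energy_density_def[abs_def] mass_slope_def[abs_def]
  by measurable

lemma profile_powr:
  assumes "0 < l"
  shows "profile l r powr p * r powr (- q) = mass_density l r"
    and "profile l r powr (2 * p - 2) * r powr (- (2 * q - 2)) = energy_density l r"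
  by (simp_all add: profile_def mass_density_def energy_density_def powr_powr mult.commute
    diff_divide_distrib algebra_simps)

lemma profile_deriv_square:
  "(profile_deriv l r)\<^sup>2 = ((2 - q) / (p - 2))\<^sup>2 * energy_density l r"
proof -
  have *: "(x powr y)\<^sup>2 = x powr (2 * y)" for x y :: real
    by (cases "x = 0") (auto simp: powr_def power2_eq_square mult_exp_exp)
  have e: "2 - 2 * q = 2 * (1 - q)" "- (2 * p - 2) / (p - 2) = 2 * (- (p - 1) / (p - 2))"
    by (simp_all add: algebra_simps minus_divide_left)
  show ?thesis
    unfolding profile_deriv_def energy_density_def e *[symmetric] power_mult_distrib
    by (simp add: power_divide power2_commute[of q 2])
qed

lemma energy_plus_slope:
  assumes "0 < l"
  shows "energy_density l r + l * mass_slope l r = mass_density l r"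
proof (cases "r = 0")
  case False
  let ?D = "r powr (2 - q)"
  have e: "r powr (2 - 2 * q) = r powr (- q) * ?D"
    by (simp add: powr_add[symmetric])
  define X where "X = (l + ?D) powr (- (2 * p - 2) / (p - 2))"
  define Y where "Y = (l + ?D) powr (- p / (p - 2))"
  have "- p / (p - 2) = - (2 * p - 2) / (p - 2) + 1" using p_gt by (simp add: field_simps)
  then have "Y = X * (l + ?D)"
    unfolding X_def Y_def using assms by (simp add: powr_add add_pos_nonneg)
  then show ?thesis
    unfolding energy_density_def mass_slope_def mass_density_def e X_def[symmetric] Y_def[symmetric]
    by (simp add: algebra_simps)
qed (simp add: energy_density_def mass_slope_def mass_density_def)

lemma mass_density_tangent:
  assumes "0 < l" "l \<le> l'"
  shows "mass_density l r \<le> mass_density l' r + p / (p - 2) * (l' - l) * mass_slope l r"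
proof -
  let ?D = "r powr (2 - q)"
  have e: "- (2 * p - 2) / (p - 2) = - (p / (p - 2)) - 1" "- p / (p - 2) = - (p / (p - 2))"
    using p_gt by (simp_all add: field_simps)
  have "(l + ?D) powr (- (p / (p - 2))) \<le> (l' + ?D) powr (- (p / (p - 2)))
      + p / (p - 2) * ((l' + ?D) - (l + ?D)) * (l + ?D) powr (- (p / (p - 2)) - 1)"
    by (rule powr_minus_ge_tangent) (use assms p_gt in \<open>auto intro!: add_pos_nonneg\<close>)
  then have "r powr (- q) * (l + ?D) powr (- (p / (p - 2))) \<le> r powr (- q) * ((l' + ?D) powr (- (p / (p - 2)))
      + p / (p - 2) * ((l' + ?D) - (l + ?D)) * (l + ?D) powr (- (p / (p - 2)) - 1))"
    by (rule mult_left_mono) simp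
  then show ?thesis
    unfolding mass_density_def mass_slope_def e by (simp add: algebra_simps)
qed

lemma mass_density_antimono:
  assumes "0 < l" "l \<le> l'"
  shows "mass_density l' r \<le> mass_density l r"
  unfolding mass_density_def using assms p_gt q_less
  by (intro mult_left_mono powr_mono2') (auto intro!: add_pos_nonneg)

lemma mass_density_decreasing:
  assumes "0 < l" "0 < r" "r \<le> r'"
  shows "mass_density l r' \<le> mass_density l r"
  unfolding mass_density_def using assms p_gt q_less q_pos
  by (intro mult_mono powr_mono2') (auto intro!: add_pos_nonneg powr_mono2)

lemma mass_density_pos: "0 < l \<Longrightarrow> 0 < r \<Longrightarrow> 0 < mass_density l r"
  unfolding mass_density_def by (intro mult_pos_pos) (auto simp: add_nonneg_eq_0_iff)

text \<open>
  The parameter \<open>l\<close> of the profiles is a dilation: this is what lets radial contraction compare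
  the masses for different \<open>l\<close>.
\<close>
lemma mass_density_scaling:
  assumes "0 < l" "0 \<le> r"
  shows "mass_density 1 (l powr (- 1 / (2 - q)) * r)
    = l powr (q / (2 - q) + p / (p - 2)) * mass_density l r"
proof -
  let ?s = "l powr (- 1 / (2 - q))" and ?D = "r powr (2 - q)"
  have "(?s * r) powr (- q) = l powr (q / (2 - q)) * r powr (- q)"
    using assms by (simp add: powr_mult powr_powr)
  moreover have "1 + (?s * r) powr (2 - q) = (l + ?D) / l"
  proof -
    have "(?s * r) powr (2 - q) = ?s powr (2 - q) * ?D" using assms by (simp add: powr_mult)
    also have "?s powr (2 - q) = l powr (- 1 / (2 - q) * (2 - q))" by (simp only: powr_powr)
    also have "\<dots> = 1 / l" using assms q_less by (simp add: powr_minus_divide)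
    finally show ?thesis using assms by (simp add: field_simps)
  qed
  moreover have "((l + ?D) / l) powr (- p / (p - 2)) = l powr (p / (p - 2)) * (l + ?D) powr (- p / (p - 2))"
    using assms by (simp add: powr_divide powr_minus field_simps add_nonneg_nonneg)
  ultimately show ?thesis by (simp add: mass_density_def powr_add)
qed

lemma profile_antimono:
  assumes "0 < l" "0 \<le> r" "r \<le> r'"
  shows "profile l r' \<le> profile l r"
  unfolding profile_def using assms p_gt q_less
  by (intro powr_mono2') (auto intro!: powr_mono2 add_pos_nonneg)

lemma profile_has_derivative:
  assumes "0 < l" "0 < r"
  shows "(profile l has_real_derivative profile_deriv l r) (at r)"
proof -
  have neg: "- (2 - q) / (p - 2) = - 1 / (p - 2) * (2 - q)" using p_gt by (simp add: field_simps)
  have *: "- 1 / (p - 2) - 1 = - (p - 1) / (p - 2)" using p_gt by (simp add: field_simps)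
  have "0 < l + r powr (2 - q)" using assms by (simp add: add_pos_nonneg)
  then have "((\<lambda>r. (l + r powr (2 - q)) powr (- 1 / (p - 2))) has_real_derivative
      - 1 / (p - 2) * (l + r powr (2 - q)) powr (- 1 / (p - 2) - 1) * ((2 - q) * r powr (2 - q - 1))) (at r)"
    using assms by (auto intro!: derivative_eq_intros)
  then show ?thesis
    unfolding profile_def[abs_def] profile_deriv_def * neg by (simp add: mult_ac)
qed

lemma profile_tendsto_0: "(\<lambda>n. profile l (real (Suc n))) \<longlonglongrightarrow> 0"
  unfolding profile_def using p_gt q_less by real_asymp

end

section \<open>Weighted masses of the extremal profiles\<close>

text \<open>
  The vertex is required to be a null point, near which \<open>d powr (- q)\<close> is integrable. Both hold if the
  integrals in the inequality are finite, and on a volume cone; they make all the masses below finite.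
\<close>
locale ckn_vertex = mcp_space m N + ckn_exponents p q
  for m :: "'a::polish_space measure" and N p q +
  fixes x0 :: 'a
  assumes N_gt: "2 < N" and N_less: "N < 2 * (p - q) / (p - 2)"
    and no_atom: "emeasure m {x0} = 0"
    and near: "(\<integral>\<^sup>+x. ennreal (dist x0 x powr (- q)) * indicator (ball x0 1) x \<partial>m) < \<infinity>"
begin

definition mass :: "real \<Rightarrow> ennreal" where
  "mass l = (\<integral>\<^sup>+x. ennreal (mass_density l (dist x0 x)) \<partial>m)"

definition energy :: "real \<Rightarrow> ennreal" where
  "energy l = (\<integral>\<^sup>+x. ennreal (energy_density l (dist x0 x)) \<partial>m)"

definition slope :: "real \<Rightarrow> ennreal" where
  "slope l = (\<integral>\<^sup>+x. ennreal (mass_slope l (dist x0 x)) \<partial>m)"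

text \<open>
  On a cone the mass of the profiles is a multiple of \<open>l powr (- cone_exponent)\<close>.
\<close>
definition cone_exponent :: real where
  "cone_exponent = p / (p - 2) - (N - q) / (2 - q)"

lemma AE_dist_pos: "AE x in m. 0 < dist x0 x"
  using no_atom by (intro AE_I[where N = "{x0}"]) auto

text \<open>
  The upper bound on \<open>N\<close> is exactly what makes the density of the mass decay faster than
  \<open>r powr (- N)\<close> at infinity.
\<close>
lemma far_exponent: "N < q + (2 - q) * (p / (p - 2))"
proof -
  have "q + (2 - q) * (p / (p - 2)) = 2 * (p - q) / (p - 2)" using p_gt by (simp add: field_simps)
  then show ?thesis using N_less by simp
qed

text \<open>
  The integrability of \<open>d powr (- q)\<close> takes care of the unit ball. Outside it, the decay beyond
  \<open>r powr (- N)\<close> outweighs the growth of volume allowed by Bishop--Gromov.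
\<close>
lemma mass_1_finite: "mass 1 < \<infinity>"
proof -
  \<comment> \<open>The rate of decay of the density at infinity.\<close>
  define \<sigma> where "\<sigma> = q + (2 - q) * (p / (p - 2))"
  have \<sigma>: "N < \<sigma>" "0 < \<sigma>" using far_exponent N_gt by (auto simp: \<sigma>_def)
  define A where "A = (\<lambda>j::nat. {x. 2 ^ j \<le> dist x0 x \<and> dist x0 x < 2 ^ Suc j})"
  have [measurable]: "A j \<in> sets borel" for j unfolding A_def by measurable
  obtain v where v: "emeasure m (ball x0 1) = ennreal v" "0 \<le> v"
    using emeasure_ball_pos_finite[OF mms, of 1 x0] by (cases "emeasure m (ball x0 1)") auto
  have two: "((2::real) ^ j) powr b = (2 powr b) ^ j" for j b
    by (simp add: powr_realpow[symmetric] powr_powr mult.commute)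
  have "(\<integral>\<^sup>+x. ennreal (mass_density 1 (dist x0 x)) * indicator (\<Union>j. A j) x \<partial>m) < \<infinity>"
  proof (rule nn_integral_finite_of_geometric_pieces)
    show "A j \<in> sets m" for j by simp
    show "ennreal (mass_density 1 (dist x0 x)) \<le> ennreal ((2 ^ j) powr (- \<sigma>))" if "x \<in> A j" for x j
    proof (rule ennreal_leI)
      let ?r = "dist x0 x"
      have r: "2 ^ j \<le> ?r" "(0::real) < 2 ^ j" using that by (auto simp: A_def)
      have "mass_density 1 ?r \<le> mass_density 1 (2 ^ j)" by (rule mass_density_decreasing) (use r in auto)
      also have "\<dots> \<le> (2 ^ j) powr (- q) * ((2 ^ j) powr (2 - q)) powr (- p / (p - 2))"
        unfolding mass_density_def using p_gt by (intro mult_left_mono powr_mono2') auto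
      also have "\<dots> = (2 ^ j) powr (- \<sigma>)"
        unfolding powr_powr powr_add[symmetric] \<sigma>_def by (simp add: algebra_simps)
      finally show "mass_density 1 ?r \<le> (2 ^ j) powr (- \<sigma>)" .
    qed
    show "ennreal ((2 ^ j) powr (- \<sigma>)) * emeasure m (A j)
        \<le> ennreal (2 powr N * v * (2 powr (N - \<sigma>)) ^ j)" for j
    proof -
      have "emeasure m (A j) \<le> emeasure m (ball x0 (2 ^ Suc j))"
        by (rule emeasure_mono) (auto simp: A_def)
      also have "\<dots> \<le> ennreal ((2 ^ Suc j / 1) powr N) * emeasure m (ball x0 1)"
        by (rule bishop_gromov) (use one_le_power[of "2::real" "Suc j"] in auto)
      also have "\<dots> = ennreal ((2 ^ Suc j) powr N * v)" using v by (simp add: ennreal_mult)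
      finally have "ennreal ((2 ^ j) powr (- \<sigma>)) * emeasure m (A j)
          \<le> ennreal ((2 ^ j) powr (- \<sigma>)) * ennreal ((2 ^ Suc j) powr N * v)"
        by (rule mult_left_mono) simp
      also have "\<dots> = ennreal ((2 ^ j) powr (- \<sigma>) * ((2 ^ Suc j) powr N * v))"
        using v by (intro ennreal_mult[symmetric]) auto
      also have "(2 ^ j) powr (- \<sigma>) * ((2 ^ Suc j) powr N * v) = 2 powr N * v * (2 powr (N - \<sigma>)) ^ j"
        unfolding two by (simp add: power_mult_distrib[symmetric] powr_add[symmetric])
      finally show ?thesis .
    qed
    show "2 powr (N - \<sigma>) < 1" using \<sigma> powr_less_mono[of "N - \<sigma>" 0 2] by simp
  qed (use v in auto)
  moreover have "mass 1 \<le> (\<integral>\<^sup>+x. ennreal (dist x0 x powr (- q)) * indicator (ball x0 1) x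
      + ennreal (mass_density 1 (dist x0 x)) * indicator (\<Union>j. A j) x \<partial>m)"
    unfolding mass_def
  proof (rule nn_integral_mono)
    fix x
    show "ennreal (mass_density 1 (dist x0 x)) \<le> ennreal (dist x0 x powr (- q)) * indicator (ball x0 1) x
      + ennreal (mass_density 1 (dist x0 x)) * indicator (\<Union>j. A j) x"
    proof (cases "dist x0 x < 1")
      case True
      have "(1 + dist x0 x powr (2 - q)) powr (- p / (p - 2)) \<le> 1 powr (- p / (p - 2))"
        using p_gt by (intro powr_mono2') auto
      then have "mass_density 1 (dist x0 x) \<le> dist x0 x powr (- q) * 1"
        unfolding mass_density_def by (intro mult_left_mono) auto
      then show ?thesis using True by (auto intro!: add_increasing2 ennreal_leI)
    next
      case False
      have d: "1 \<le> dist x0 x" "0 < dist x0 x" using False by linarith+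
      have "0 \<le> log 2 (dist x0 x)" using d by simp
      then have "real (nat \<lfloor>log 2 (dist x0 x)\<rfloor>) \<le> log 2 (dist x0 x)"
        "log 2 (dist x0 x) < real (nat \<lfloor>log 2 (dist x0 x)\<rfloor>) + 1" by linarith+
      then obtain j :: nat where j: "real j \<le> log 2 (dist x0 x)" "log 2 (dist x0 x) < real j + 1"
        by blast
      then have "2 powr real j \<le> dist x0 x" "dist x0 x < 2 powr (real j + 1)"
        using le_log_iff[of 2 "dist x0 x" "real j"] log_less_iff[of 2 "dist x0 x" "real j + 1"] d
        by simp_all
      then have "x \<in> A j" by (auto simp: A_def powr_add powr_realpow mult.commute)
      then have "x \<in> (\<Union>j. A j)" by blast
      then show ?thesis by simp
    qed
  qed
  moreover have "\<dots> = (\<integral>\<^sup>+x. ennreal (dist x0 x powr (- q)) * indicator (ball x0 1) x \<partial>m)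
      + (\<integral>\<^sup>+x. ennreal (mass_density 1 (dist x0 x)) * indicator (\<Union>j. A j) x \<partial>m)"
    by (rule nn_integral_add)
       (auto intro!: borel_measurable_m borel_measurable_times_ennreal borel_measurable_indicator; measurable)+
  ultimately show ?thesis using near
    by (metis (no_types, lifting) ennreal_add_eq_top infinity_ennreal_def less_top top.extremum_unique)
qed

lemma mass_antimono: "0 < l \<Longrightarrow> l \<le> l' \<Longrightarrow> mass l' \<le> mass l"
  unfolding mass_def by (intro nn_integral_mono ennreal_leI mass_density_antimono)

lemma mass_finite: "1 \<le> l \<Longrightarrow> mass l < \<infinity>"
  using mass_antimono[of 1 l] mass_1_finite by (simp add: le_less_trans)

lemma mass_eq_energy_plus_slope:
  assumes "0 < l"
  shows "mass l = energy l + ennreal l * slope l"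
proof -
  have "mass l = (\<integral>\<^sup>+x. ennreal (energy_density l (dist x0 x)) + ennreal l * ennreal (mass_slope l (dist x0 x)) \<partial>m)"
    unfolding mass_def energy_plus_slope[OF assms, symmetric] using assms
    by (simp add: ennreal_mult)
  also have "\<dots> = energy l + ennreal l * slope l"
    unfolding energy_def slope_def
    by (simp add: nn_integral_add nn_integral_cmult borel_measurable_m)
  finally show ?thesis .
qed

text \<open>
  The tangent inequality for the convex function \<open>mass\<close>, obtained by integrating pointwise tangents
  rather than by differentiating under the integral sign.
\<close>
lemma mass_convex:
  assumes "0 < l" "l \<le> l'"
  shows "mass l \<le> mass l' + ennreal (p / (p - 2) * (l' - l)) * slope l"
proof -
  have c: "0 \<le> p / (p - 2) * (l' - l)" using assms p_gt by simp
  have *: "ennreal (mass_density l r) \<le> ennreal (mass_density l' r)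
      + ennreal (p / (p - 2) * (l' - l)) * ennreal (mass_slope l r)" for r
  proof -
    have "ennreal (mass_density l r)
        \<le> ennreal (mass_density l' r + p / (p - 2) * (l' - l) * mass_slope l r)"
      by (rule ennreal_leI) (rule mass_density_tangent[OF assms])
    also have "\<dots> = ennreal (mass_density l' r) + ennreal (p / (p - 2) * (l' - l) * mass_slope l r)"
      using mult_nonneg_nonneg[OF c mass_slope_nonneg[of l r]] by (intro ennreal_plus) simp_all
    also have "ennreal (p / (p - 2) * (l' - l) * mass_slope l r)
        = ennreal (p / (p - 2) * (l' - l)) * ennreal (mass_slope l r)"
      using c by (intro ennreal_mult) auto
    finally show ?thesis .
  qed
  have "mass l \<le> (\<integral>\<^sup>+x. ennreal (mass_density l' (dist x0 x))
      + ennreal (p / (p - 2) * (l' - l)) * ennreal (mass_slope l (dist x0 x)) \<partial>m)"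
    unfolding mass_def by (rule nn_integral_mono) (rule *)
  also have "\<dots> = mass l' + ennreal (p / (p - 2) * (l' - l)) * slope l"
    unfolding mass_def slope_def
    by (simp add: nn_integral_add nn_integral_cmult borel_measurable_m)
  finally show ?thesis .
qed

lemma mass_contraction:
  assumes "1 \<le> l"
  shows "ennreal (l powr cone_exponent) * mass l
      = ennreal ((l powr (- 1 / (2 - q))) powr N) *
        (\<integral>\<^sup>+x. ennreal (mass_density 1 (l powr (- 1 / (2 - q)) * dist x0 x)) \<partial>m)"
    and "ennreal (l powr cone_exponent) * mass l \<le> mass 1"
proof -
  let ?s = "l powr (- 1 / (2 - q))"
  have e: "?s powr N * l powr (q / (2 - q) + p / (p - 2)) = l powr cone_exponent"
    unfolding powr_powr powr_add[symmetric] cone_exponent_def using q_less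
    by (simp add: diff_divide_distrib algebra_simps)
  have "(\<integral>\<^sup>+x. ennreal (mass_density 1 (?s * dist x0 x)) \<partial>m)
     = (\<integral>\<^sup>+x. ennreal (l powr (q / (2 - q) + p / (p - 2))) * ennreal (mass_density l (dist x0 x)) \<partial>m)"
    using assms by (intro nn_integral_cong) (subst mass_density_scaling, auto intro: ennreal_mult)
  also have "\<dots> = ennreal (l powr (q / (2 - q) + p / (p - 2))) * mass l"
    unfolding mass_def by (rule nn_integral_cmult) (simp add: borel_measurable_m)
  finally have "ennreal (?s powr N) * (\<integral>\<^sup>+x. ennreal (mass_density 1 (?s * dist x0 x)) \<partial>m)
     = ennreal (?s powr N) * (ennreal (l powr (q / (2 - q) + p / (p - 2))) * mass l)"
    by simp
  also have "\<dots> = ennreal (l powr cone_exponent) * mass l"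
    unfolding e[symmetric] by (simp add: ennreal_mult mult.assoc)
  finally show *: "ennreal (l powr cone_exponent) * mass l
      = ennreal (?s powr N) * (\<integral>\<^sup>+x. ennreal (mass_density 1 (?s * dist x0 x)) \<partial>m)" ..
  have "?s \<le> l powr 0" using assms q_less by (intro powr_mono) auto
  then have s: "0 < ?s" "?s \<le> 1" using assms by auto
  show "ennreal (l powr cone_exponent) * mass l \<le> mass 1"
    unfolding * unfolding mass_def
    using radial_contraction[of "\<lambda>r. ennreal (mass_density 1 r)" ?s x0] s by simp
qed

lemma mass_1_pos: "0 < mass 1"
proof (rule ccontr)
  assume "\<not> 0 < mass 1"
  then have "AE x in m. ennreal (mass_density 1 (dist x0 x)) = 0"
    by (simp add: mass_def nn_integral_0_iff_AE borel_measurable_m)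
  then have "AE x in m. False"
    using AE_dist_pos
  proof eventually_elim
    case (elim x)
    then show False using mass_density_pos[of 1 "dist x0 x"] by (simp add: ennreal_eq_0_iff)
  qed
  then have "emeasure m UNIV = 0" by (simp add: AE_iff_null null_sets_def)
  then show False
    using emeasure_ball_pos_finite(1)[OF mms, of 1 x0] emeasure_mono[of "ball x0 1" UNIV m] by simp
qed

end

section \<open>Truncated extremal profiles as test functions\<close>

context ckn_vertex
begin

text \<open>
  Truncation acts on the values of the profile. Hence it decreases the function and its
  oscillation, so the energies on the left-hand side of the inequality stay below those of the
  untruncated profile with no error term.
\<close>
definition truncated_profile :: "real \<Rightarrow> real \<Rightarrow> real \<Rightarrow> 'a \<Rightarrow> real" where
  "truncated_profile l e R x = max 0 (min (profile l (dist x0 x)) (profile l e) - profile l R)"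

lemma truncated_profile_nonneg: "0 \<le> truncated_profile l e R x"
  by (simp add: truncated_profile_def)

lemma truncated_profile_le: "truncated_profile l e R x \<le> profile l (dist x0 x)"
  using profile_nonneg[of l R] profile_nonneg[of l "dist x0 x"]
  unfolding truncated_profile_def by linarith

lemma truncated_profile_diff:
  "\<bar>truncated_profile l e R y - truncated_profile l e R x\<bar>
    \<le> \<bar>profile l (dist x0 y) - profile l (dist x0 x)\<bar>"
  by (simp add: truncated_profile_def max_def min_def)

text \<open>
  Truncating the values amounts to clamping the distance to \<open>{e..R}\<close>, an interval on which
  the profile has bounded derivative.
\<close>
lemma truncated_profile_in_Lip_c:
  assumes l: "0 < l" and e: "0 < e" "e \<le> R"
  shows "truncated_profile l e R \<in> Lip_c"
proof -
  define cl where "cl = (\<lambda>r. min R (max e r))"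
  have cl: "cl r \<in> {e..R}" for r using e by (auto simp: cl_def)
  have eq: "truncated_profile l e R x = profile l (cl (dist x0 x)) - profile l R" for x
    using profile_antimono[OF l, of "dist x0 x" e] profile_antimono[OF l, of e "dist x0 x"]
      profile_antimono[OF l, of "dist x0 x" R] profile_antimono[OF l, of R "dist x0 x"]
      profile_antimono[OF l, of e R] e
    unfolding truncated_profile_def cl_def
    by (auto simp: max_def min_def not_le)
  have "continuous_on {e..R} (profile_deriv l)"
    unfolding profile_deriv_def[abs_def] using e l
    by (intro continuous_intros) (auto simp: add_nonneg_eq_0_iff)
  then have "bounded (profile_deriv l ` {e..R})"
    by (intro compact_imp_bounded compact_continuous_image) auto
  then obtain L where L: "0 < L" "\<And>r. r \<in> {e..R} \<Longrightarrow> \<bar>profile_deriv l r\<bar> \<le> L"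
    by (auto simp: bounded_pos)
  have "L-lipschitz_on UNIV (truncated_profile l e R)"
  proof (rule lipschitz_onI)
    fix x y
    have "\<bar>profile l (cl (dist x0 x)) - profile l (cl (dist x0 y))\<bar>
        \<le> L * \<bar>cl (dist x0 x) - cl (dist x0 y)\<bar>"
      unfolding real_norm_def[symmetric]
    proof (rule field_differentiable_bound[where S = "{e..R}"])
      fix r assume "r \<in> {e..R}"
      then show "(profile l has_field_derivative profile_deriv l r) (at r within {e..R})"
        using e profile_has_derivative[OF l, of r] by (auto intro: has_field_derivative_at_within)
    qed (use L(2) cl in auto)
    also have "\<bar>cl (dist x0 x) - cl (dist x0 y)\<bar> \<le> \<bar>dist x0 x - dist x0 y\<bar>"
      by (simp add: cl_def max_def min_def)
    also have "\<dots> \<le> dist x y" using abs_dist_diff_le[of x x0 y] by (simp add: dist_commute)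
    finally show "dist (truncated_profile l e R x) (truncated_profile l e R y) \<le> L * dist x y"
      using L(1) by (simp add: eq dist_real_def mult_left_mono)
  qed (use L in simp)
  moreover have "compact (closure {x. truncated_profile l e R x \<noteq> 0})"
  proof -
    have "{x. truncated_profile l e R x \<noteq> 0} \<subseteq> cball x0 R"
    proof
      fix x assume "x \<in> {x. truncated_profile l e R x \<noteq> 0}"
      then have "\<not> R \<le> dist x0 x" by (auto simp: eq cl_def)
      then show "x \<in> cball x0 R" by simp
    qed
    then have "closure {x. truncated_profile l e R x \<noteq> 0} \<subseteq> cball x0 R"
      by (rule closure_minimal) simp
    then show ?thesis
      using compact_Int_closed[OF compact_cball_mcp closed_closure] by (metis inf.absorb2)
  qed
  ultimately show ?thesis by (auto simp: Lip_c_def)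
qed

lemma truncated_profile_energy:
  assumes "0 < l"
  shows "(\<integral>\<^sup>+x. (loc_lip (truncated_profile l e R) x)\<^sup>2 \<partial>m) \<le> ennreal (((2 - q) / (p - 2))\<^sup>2) * energy l"
proof -
  have "(\<integral>\<^sup>+x. (loc_lip (truncated_profile l e R) x)\<^sup>2 \<partial>m)
      \<le> (\<integral>\<^sup>+x. ennreal (((2 - q) / (p - 2))\<^sup>2) * ennreal (energy_density l (dist x0 x)) \<partial>m)"
  proof (rule nn_integral_mono_AE, use AE_dist_pos in eventually_elim)
    fix x assume x: "0 < dist x0 x"
    have "loc_lip (truncated_profile l e R) x \<le> ennreal \<bar>profile_deriv l (dist x0 x)\<bar>"
      by (rule loc_lip_le_radial[OF profile_has_derivative[OF assms x] truncated_profile_diff])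
    then have "(loc_lip (truncated_profile l e R) x)\<^sup>2 \<le> (ennreal \<bar>profile_deriv l (dist x0 x)\<bar>)\<^sup>2"
      by (rule power_mono) simp
    also have "\<dots> = ennreal (((2 - q) / (p - 2))\<^sup>2 * energy_density l (dist x0 x))"
      by (simp add: ennreal_power profile_deriv_square)
    also have "\<dots> = ennreal (((2 - q) / (p - 2))\<^sup>2) * ennreal (energy_density l (dist x0 x))"
      by (rule ennreal_mult) simp_all
    finally show "(loc_lip (truncated_profile l e R) x)\<^sup>2
      \<le> ennreal (((2 - q) / (p - 2))\<^sup>2) * ennreal (energy_density l (dist x0 x))" .
  qed
  also have "\<dots> = ennreal (((2 - q) / (p - 2))\<^sup>2) * energy l"
    unfolding energy_def by (rule nn_integral_cmult) (simp add: borel_measurable_m)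
  finally show ?thesis .
qed

lemma truncated_profile_weighted:
  assumes "0 < l"
  shows "(\<integral>\<^sup>+x. epowr \<bar>truncated_profile l e R x\<bar> (2 * p - 2) / epowr (dist x0 x) (2 * q - 2) \<partial>m)
    \<le> energy l"
  unfolding energy_def
proof (rule nn_integral_mono_AE, use AE_dist_pos in eventually_elim)
  fix x assume x: "0 < dist x0 x"
  let ?u = "truncated_profile l e R x"
  have "epowr \<bar>?u\<bar> (2 * p - 2) / epowr (dist x0 x) (2 * q - 2)
      = ennreal (?u powr (2 * p - 2) * dist x0 x powr (- (2 * q - 2)))"
    using epowr_divide[of "\<bar>?u\<bar>" "2 * p - 2" "dist x0 x" "2 * q - 2"] x p_gt
      truncated_profile_nonneg[of l e R x] by simp
  also have "\<dots> \<le> ennreal (profile l (dist x0 x) powr (2 * p - 2) * dist x0 x powr (- (2 * q - 2)))"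
    using p_gt truncated_profile_nonneg truncated_profile_le
    by (intro ennreal_leI mult_right_mono powr_mono2) auto
  finally show "epowr \<bar>?u\<bar> (2 * p - 2) / epowr (dist x0 x) (2 * q - 2)
      \<le> ennreal (energy_density l (dist x0 x))"
    by (simp only: profile_powr[OF assms])
qed

lemma truncated_profile_tendsto:
  assumes "0 < l" "0 < dist x0 x"
  shows "(\<lambda>n. truncated_profile l (1 / real (Suc n)) (real (Suc n)) x) \<longlonglongrightarrow> profile l (dist x0 x)"
proof -
  have "\<forall>\<^sub>F n in sequentially. 1 / real (Suc n) < dist x0 x"
    using lim_inverse_n' assms(2) LIMSEQ_Suc[OF lim_inverse_n'] by (intro order_tendstoD) auto
  then have ev: "\<forall>\<^sub>F n in sequentially. max 0 (profile l (dist x0 x) - profile l (real (Suc n)))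
      = truncated_profile l (1 / real (Suc n)) (real (Suc n)) x"
  proof eventually_elim
    case (elim n)
    then have "profile l (dist x0 x) \<le> profile l (1 / real (Suc n))"
      using assms by (intro profile_antimono) auto
    then show ?case by (simp add: truncated_profile_def)
  qed
  have "(\<lambda>n. max 0 (profile l (dist x0 x) - profile l (real (Suc n)))) \<longlonglongrightarrow> max 0 (profile l (dist x0 x) - 0)"
    by (intro tendsto_intros profile_tendsto_0)
  then show ?thesis using Lim_transform_eventually[OF _ ev] by simp
qed

text \<open>
  The left-hand side is bounded uniformly along the truncations, so Fatou's lemma on the right-hand
  side is enough to reach the profile itself.
\<close>
lemma CKN_bounds_mass_by_energy:
  assumes ckn: "CKN_inequality m p q x0 C" and C: "0 < C" and l: "0 < l" and fin: "energy l < \<infinity>"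
  shows "mass l \<le> ennreal ((2 - q) / (p - 2) / sqrt C) * energy l"
proof -
  define u where "u = (\<lambda>n. truncated_profile l (1 / real (Suc n)) (real (Suc n)))"
  define P where "P = (\<lambda>n. \<integral>\<^sup>+x. ennreal (u n x powr p * dist x0 x powr (- q)) \<partial>m)"
  obtain g where g: "energy l = ennreal g" "0 \<le> g" using fin by (cases "energy l") auto
  define c where "c = (2 - q) / (p - 2)"
  have c: "0 < c" using q_less p_gt by (simp add: c_def)
  have P_le: "P n \<le> ennreal (c / sqrt C) * energy l" for n
  proof -
    have u: "u n \<in> Lip_c"
      unfolding u_def by (rule truncated_profile_in_Lip_c) (use l in \<open>auto simp: field_simps\<close>)
    have "P n = (\<integral>\<^sup>+x. epowr \<bar>u n x\<bar> p / epowr (dist x0 x) q \<partial>m)"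
      unfolding P_def
    proof (rule nn_integral_cong_AE, use AE_dist_pos in eventually_elim)
      fix x assume "0 < dist x0 x"
      then show "ennreal (u n x powr p * dist x0 x powr (- q)) = epowr \<bar>u n x\<bar> p / epowr (dist x0 x) q"
        using epowr_divide[of "\<bar>u n x\<bar>" p "dist x0 x" q] p_gt
          truncated_profile_nonneg[of l _ _ x] by (simp add: u_def)
    qed
    then have "ennreal C * (P n)\<^sup>2 \<le> (\<integral>\<^sup>+x. (loc_lip (u n) x)\<^sup>2 \<partial>m) *
        (\<integral>\<^sup>+x. epowr \<bar>u n x\<bar> (2 * p - 2) / epowr (dist x0 x) (2 * q - 2) \<partial>m)"
      using ckn u by (simp add: CKN_inequality_def)
    also have "\<dots> \<le> (ennreal (c\<^sup>2) * energy l) * energy l"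
      unfolding u_def c_def using l
      by (intro mult_mono truncated_profile_energy truncated_profile_weighted) auto
    also have "\<dots> = ennreal ((c * g)\<^sup>2)"
      using g c by (simp add: ennreal_mult[symmetric] power2_eq_square mult_ac)
    finally have *: "ennreal C * (P n)\<^sup>2 \<le> ennreal ((c * g)\<^sup>2)" .
    then have "P n \<noteq> \<top>"
      using C by (auto simp: ennreal_mult_top top_unique power2_eq_square)
    then obtain s where s: "P n = ennreal s" "0 \<le> s" by (cases "P n") auto
    have "C * s\<^sup>2 \<le> (c * g)\<^sup>2"
      using * s C by (simp add: ennreal_power ennreal_mult[symmetric])
    then have "(sqrt C * s)\<^sup>2 \<le> (c * g)\<^sup>2" using C by (simp add: power_mult_distrib)
    then have "sqrt C * s \<le> c * g"
      by (rule power2_le_imp_le) (use c g in auto)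
    then have "s \<le> c / sqrt C * g" using C by (simp add: field_simps)
    then have "ennreal s \<le> ennreal (c / sqrt C * g)" by (rule ennreal_leI)
    also have "\<dots> = ennreal (c / sqrt C) * ennreal g" using c C g by (intro ennreal_mult) auto
    finally show ?thesis using s g by simp
  qed
  have "mass l = (\<integral>\<^sup>+x. liminf (\<lambda>n. ennreal (u n x powr p * dist x0 x powr (- q))) \<partial>m)"
    unfolding mass_def
  proof (rule nn_integral_cong_AE, use AE_dist_pos in eventually_elim)
    fix x assume x: "0 < dist x0 x"
    have "(\<lambda>n. ennreal (u n x powr p * dist x0 x powr (- q)))
        \<longlonglongrightarrow> ennreal (profile l (dist x0 x) powr p * dist x0 x powr (- q))"
      unfolding u_def using p_gt truncated_profile_nonneg
      by (intro tendsto_intros tendsto_ennrealI tendsto_powr2 truncated_profile_tendsto[OF l x]) auto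
    then show "ennreal (mass_density l (dist x0 x))
        = liminf (\<lambda>n. ennreal (u n x powr p * dist x0 x powr (- q)))"
      unfolding profile_powr[OF l] by (intro lim_imp_Liminf[symmetric]) auto
  qed
  also have "\<dots> \<le> liminf P"
    unfolding P_def
  proof (rule nn_integral_liminf)
    show "(\<lambda>x. ennreal (u n x powr p * dist x0 x powr (- q))) \<in> borel_measurable m" for n
      unfolding u_def truncated_profile_def[abs_def] profile_def[abs_def]
      by (rule borel_measurable_m) measurable
  qed
  also have "\<dots> \<le> ennreal (c / sqrt C) * energy l"
    by (rule Liminf_le) (auto simp: P_le)
  finally show ?thesis by (simp add: c_def)
qed

end

section \<open>Sharpness of the constant and rigidity\<close>

context ckn_vertex
begin

text \<open>
  Eliminating the slope between \<open>mass_eq_energy_plus_slope\<close>, \<open>mass_convex\<close> and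
  \<open>CKN_bounds_mass_by_energy\<close> leaves the step condition of the discrete Gronwall lemma.
\<close>
lemma CKN_mass_growth:
  assumes ckn: "CKN_inequality m p q x0 C" and C: "0 < C" and r: "1 < r"
  shows "mass 1 \<le> ennreal (r powr (p / (p - 2) - p * sqrt C / (2 - q))) * mass r"
proof -
  define a where "a = p / (p - 2) - p * sqrt C / (2 - q)"
  define f where "f = (\<lambda>l. enn2real (mass l))"
  have f: "mass l = ennreal (f l)" "0 \<le> f l" if "1 \<le> l" for l
    using mass_finite[OF that] by (auto simp: f_def)
  have "f 1 \<le> r powr a * f r"
  proof (rule powr_lower_bound_of_infinitesimal[OF _ _ r])
    fix l l' :: real assume l: "1 \<le> l" "l \<le> l'"
    have fl: "mass l = ennreal (f l)" "mass l' = ennreal (f l')" "0 \<le> f l" "0 \<le> f l'"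
      using f[of l] f[of l'] l by auto
    have sum: "mass l = energy l + ennreal l * slope l"
      using l by (intro mass_eq_energy_plus_slope) auto
    have "energy l < \<infinity>" "ennreal l * slope l < \<infinity>"
      using mass_finite[OF l(1)] unfolding sum by auto
    moreover from this have "slope l < \<infinity>" using l by (auto simp: ennreal_mult_less_top)
    ultimately obtain g e where g: "energy l = ennreal g" "0 \<le> g" and e: "slope l = ennreal e" "0 \<le> e"
      by (cases "energy l"; cases "slope l") auto
    \<comment> \<open>The three relations between mass, energy and slope, now between real numbers.\<close>
    have 1: "f l = g + l * e"
    proof -
      have "ennreal (f l) = ennreal (g + l * e)"
        using sum fl g e l by (simp add: ennreal_mult)
      then show ?thesis using fl g e l by (subst (asm) ennreal_inj) auto
    qed
    have c0: "0 \<le> (2 - q) / (p - 2) / sqrt C" "0 \<le> p / (p - 2) * (l' - l)"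
      using q_less p_gt C l by auto
    have 2: "f l \<le> (2 - q) / (p - 2) / sqrt C * g"
    proof -
      have "ennreal (f l) \<le> ennreal ((2 - q) / (p - 2) / sqrt C * g)"
        using CKN_bounds_mass_by_energy[OF ckn C, of l] l fl g c0
          ennreal_mult[OF c0(1) g(2)] by simp
      then show ?thesis by (simp only: ennreal_le_iff[OF mult_nonneg_nonneg[OF c0(1) g(2)]])
    qed
    have 3: "f l \<le> f l' + p / (p - 2) * (l' - l) * e"
    proof -
      have "ennreal (f l) \<le> ennreal (f l' + p / (p - 2) * (l' - l) * e)"
        using mass_convex[of l l'] l fl e c0 ennreal_mult[OF c0(2) e(2)]
          ennreal_plus[OF fl(4) mult_nonneg_nonneg[OF c0(2) e(2)]] by simp
      then show ?thesis
        by (simp only: ennreal_le_iff[OF add_nonneg_nonneg[OF fl(4) mult_nonneg_nonneg[OF c0(2) e(2)]]])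
    qed
    have "sqrt C * f l \<le> (2 - q) / (p - 2) * (f l - l * e)"
    proof -
      have "sqrt C * f l \<le> sqrt C * ((2 - q) / (p - 2) / sqrt C * g)"
        using 2 by (rule mult_left_mono) (use C in simp)
      also have "\<dots> = (2 - q) / (p - 2) * g" using C by simp
      finally show ?thesis by (simp add: 1)
    qed
    then have "sqrt C * f l / ((2 - q) / (p - 2)) \<le> f l - l * e"
      using q_less p_gt by (subst pos_divide_le_eq) (auto simp: mult.commute)
    moreover have "sqrt C * f l / ((2 - q) / (p - 2)) = (p - 2) * sqrt C / (2 - q) * f l"
      by simp
    ultimately have "l * e \<le> (1 - (p - 2) * sqrt C / (2 - q)) * f l"
      unfolding left_diff_distrib by linarith
    then have "p / (p - 2) * (l' / l - 1) * (l * e)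
        \<le> p / (p - 2) * (l' / l - 1) * ((1 - (p - 2) * sqrt C / (2 - q)) * f l)"
      using q_less p_gt l by (intro mult_left_mono mult_nonneg_nonneg) auto
    also have "\<dots> = p / (p - 2) * (1 - (p - 2) * sqrt C / (2 - q)) * (l' / l - 1) * f l"
      by (simp only: mult_ac)
    also have "p / (p - 2) * (1 - (p - 2) * sqrt C / (2 - q)) = a"
      using q_less p_gt by (simp add: a_def field_simps)
    also have "p / (p - 2) * (l' / l - 1) * (l * e) = p / (p - 2) * ((l' / l - 1) * l) * e"
      by (simp only: mult_ac)
    also have "(l' / l - 1) * l = l' - l" using l by (simp add: field_simps)
    finally show "f l * (1 - a * (l' / l - 1)) \<le> f l'" using 3 by (simp add: algebra_simps)
  qed (use f in auto)
  then have "ennreal (f 1) \<le> ennreal (r powr a * f r)" by (rule ennreal_leI)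
  then show ?thesis using f[of 1] f[of r] r by (simp add: ennreal_mult a_def)
qed

text \<open>
  A larger constant forces the mass to decay more slowly in \<open>l\<close> than radial contraction permits.
\<close>
lemma CKN_constant_upper_bound:
  assumes ckn: "CKN_inequality m p q x0 C"
  shows "C \<le> (N - q)\<^sup>2 / p\<^sup>2"
proof (rule ccontr)
  assume "\<not> ?thesis"
  then have "(N - q)\<^sup>2 / p\<^sup>2 < C" by simp
  then have less: "((N - q) / p)\<^sup>2 < C" by (simp add: power_divide)
  have pos: "0 < (N - q) / p" using N_gt q_less p_gt by simp
  have C: "0 < C" using less zero_le_power2[of "(N - q) / p"] by linarith
  have s: "(N - q) / p < sqrt C" using less pos by (intro real_less_rsqrt)
  define a where "a = p / (p - 2) - p * sqrt C / (2 - q)"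
  have "(N - q) / (2 - q) < p * sqrt C / (2 - q)"
    using s p_gt q_less by (intro divide_strict_right_mono) (auto simp: field_simps)
  then have a: "a < cone_exponent" by (simp add: a_def cone_exponent_def)
  obtain f1 f2 where f: "mass 1 = ennreal f1" "0 < f1" "mass 2 = ennreal f2" "0 \<le> f2"
    using mass_finite[of 1] mass_finite[of 2] mass_1_pos by (cases "mass 1"; cases "mass 2") auto
  have "f1 \<le> 2 powr a * f2"
    using CKN_mass_growth[OF ckn C, of 2] f
    by (simp add: a_def ennreal_mult[symmetric] ennreal_le_iff)
  moreover have "2 powr cone_exponent * f2 \<le> f1"
    using mass_contraction(2)[of 2] f by (simp add: ennreal_mult[symmetric] ennreal_le_iff)
  moreover have "f2 \<noteq> 0" using calculation(1) f by auto
  then have "2 powr a * f2 < 2 powr cone_exponent * f2" using a f by simp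
  ultimately show False by linarith
qed

text \<open>
  For the critical constant the exponent in \<open>CKN_mass_growth\<close> is \<open>cone_exponent\<close>, so that lemma is
  radial contraction of the density with the inequality reversed.
\<close>
lemma CKN_imp_scaling_equality:
  assumes ckn: "CKN_inequality m p q x0 ((N - q)\<^sup>2 / p\<^sup>2)" and s: "0 < s" "s \<le> 1"
  shows "(\<integral>\<^sup>+x. ennreal (mass_density 1 (dist x0 x)) \<partial>m)
    \<le> ennreal (s powr N) * (\<integral>\<^sup>+x. ennreal (mass_density 1 (s * dist x0 x)) \<partial>m)"
proof (cases "s = 1")
  case False
  \<comment> \<open>The parameter for which dilation by \<open>s\<close> turns the density for \<open>1\<close> into the one for \<open>l\<close>.\<close>
  define l where "l = s powr (- (2 - q))"
  have "s powr 0 < s powr (- (2 - q))" using s False q_less by (intro powr_less_mono') auto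
  then have l: "1 < l" using s by (simp add: l_def)
  have "- (2 - q) * (- 1 / (2 - q)) = 1" using q_less by (simp add: field_simps)
  then have sl: "l powr (- 1 / (2 - q)) = s" using s by (simp only: l_def powr_powr) simp
  have "0 < (N - q)\<^sup>2 / p\<^sup>2" using N_gt q_less p_gt by simp
  from CKN_mass_growth[OF ckn this l]
  have "mass 1 \<le> ennreal (l powr (p / (p - 2) - p * sqrt ((N - q)\<^sup>2 / p\<^sup>2) / (2 - q))) * mass l" .
  also have "p * sqrt ((N - q)\<^sup>2 / p\<^sup>2) = N - q"
    using N_gt q_less p_gt by (simp add: real_sqrt_divide)
  finally show ?thesis
    using mass_contraction(1)[of l] l unfolding sl cone_exponent_def mass_def by simp
qed simp

text \<open>
  Contraction holds for \<open>\<psi>\<close> and for \<open>c * mass_density 1 - \<psi>\<close>. It is an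
  equality for their sum, whose integral is finite, so it is an equality for each of them.
\<close>
lemma scaling_equality_dominated:
  fixes \<psi> :: "real \<Rightarrow> real"
  assumes s: "0 < s" "s \<le> 1"
    and eq: "(\<integral>\<^sup>+x. ennreal (mass_density 1 (dist x0 x)) \<partial>m)
      \<le> ennreal (s powr N) * (\<integral>\<^sup>+x. ennreal (mass_density 1 (s * dist x0 x)) \<partial>m)"
    and [measurable]: "\<psi> \<in> borel_measurable borel"
    and dom: "\<And>r. 0 \<le> \<psi> r" "\<And>r. \<psi> r \<le> c * mass_density 1 r" and c: "0 \<le> c"
  shows "ennreal (s powr N) * (\<integral>\<^sup>+x. ennreal (\<psi> (s * dist x0 x)) \<partial>m)
    = (\<integral>\<^sup>+x. ennreal (\<psi> (dist x0 x)) \<partial>m)"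
proof -
  define \<eta> where "\<eta> = (\<lambda>r. c * mass_density 1 r - \<psi> r)"
  have [measurable]: "\<eta> \<in> borel_measurable borel" unfolding \<eta>_def by measurable
  have \<eta>: "0 \<le> \<eta> r" for r using dom by (simp add: \<eta>_def)
  have split: "ennreal c * (\<integral>\<^sup>+x. ennreal (mass_density 1 (t * dist x0 x)) \<partial>m)
      = (\<integral>\<^sup>+x. ennreal (\<psi> (t * dist x0 x)) \<partial>m) + (\<integral>\<^sup>+x. ennreal (\<eta> (t * dist x0 x)) \<partial>m)" for t
  proof -
    have "ennreal c * ennreal (mass_density 1 r) = ennreal (\<psi> r) + ennreal (\<eta> r)" for r
      using c dom \<eta>[of r] by (simp add: ennreal_mult[symmetric] ennreal_plus[symmetric] \<eta>_def del: ennreal_plus)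
    then show ?thesis
      by (subst nn_integral_cmult[symmetric])
        (simp_all add: nn_integral_add borel_measurable_m)
  qed
  let ?I = "\<lambda>\<phi> t. \<integral>\<^sup>+x. ennreal (\<phi> (t * dist x0 x)) \<partial>m"
  have le: "ennreal (s powr N) * ?I \<phi> s \<le> ?I \<phi> 1" if "\<phi> \<in> borel_measurable borel" for \<phi>
    using radial_contraction[of "\<lambda>r. ennreal (\<phi> r)" s x0] s that by simp
  have "?I \<psi> 1 + ?I \<eta> 1 = ennreal c * ?I (mass_density 1) 1" using split[of 1] by simp
  also have "\<dots> \<le> ennreal c * (ennreal (s powr N) * ?I (mass_density 1) s)"
    using eq by (intro mult_left_mono) auto
  also have "\<dots> = ennreal (s powr N) * (?I \<psi> s + ?I \<eta> s)"
    unfolding split[of s, symmetric] by (rule mult.left_commute)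
  also have "\<dots> = ennreal (s powr N) * ?I \<psi> s + ennreal (s powr N) * ?I \<eta> s"
    by (rule distrib_left)
  also have "\<dots> \<le> ennreal (s powr N) * ?I \<psi> s + ?I \<eta> 1"
    by (intro add_left_mono le) simp
  finally have *: "?I \<eta> 1 + ?I \<psi> 1 \<le> ?I \<eta> 1 + ennreal (s powr N) * ?I \<psi> s"
    by (simp add: add.commute)
  have "?I \<eta> 1 \<le> ennreal c * mass 1"
    using split[of 1] by (simp add: mass_def)
  also have "\<dots> < \<infinity>" using mass_1_finite by (simp add: ennreal_mult_less_top)
  finally have "?I \<psi> 1 \<le> ennreal (s powr N) * ?I \<psi> s"
    using * by (auto simp: ennreal_add_left_cancel_le)
  then show ?thesis using le[of \<psi>] by (simp add: antisym)
qed

lemma CKN_imp_ball_scaling: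
  assumes ckn: "CKN_inequality m p q x0 ((N - q)\<^sup>2 / p\<^sup>2)" and r: "0 < r" "r \<le> R"
  shows "emeasure m (ball x0 R) = ennreal ((R / r) powr N) * emeasure m (ball x0 r)"
proof -
  define s where "s = r / R"
  have s: "0 < s" "s \<le> 1" using r by (auto simp: s_def)
  \<comment> \<open>The density is decreasing on \<open>{0<..}\<close> and vanishes at \<open>0\<close> by the convention \<open>0 powr a = 0\<close>:
    it dominates the indicator of the open interval, with constant \<open>1 / mass_density 1 r\<close>.\<close>
  define \<psi> :: "real \<Rightarrow> real" where "\<psi> = indicator {0<..<r}"
  have pos: "0 < mass_density 1 r" using r by (simp add: mass_density_pos)
  have int: "(\<integral>\<^sup>+x. ennreal (\<psi> (t * dist x0 x)) \<partial>m) = emeasure m (ball x0 (r / t))" if "0 < t" for t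
  proof -
    have "(\<integral>\<^sup>+x. ennreal (\<psi> (t * dist x0 x)) \<partial>m) = (\<integral>\<^sup>+x. indicator (ball x0 (r / t)) x \<partial>m)"
      using that by (intro nn_integral_cong_AE, use AE_dist_pos in eventually_elim)
        (auto simp: \<psi>_def field_simps split: split_indicator)
    then show ?thesis by simp
  qed
  have "ennreal (s powr N) * (\<integral>\<^sup>+x. ennreal (\<psi> (s * dist x0 x)) \<partial>m) = (\<integral>\<^sup>+x. ennreal (\<psi> (dist x0 x)) \<partial>m)"
  proof (rule scaling_equality_dominated[OF s CKN_imp_scaling_equality[OF ckn s]])
    show "\<psi> \<in> borel_measurable borel" unfolding \<psi>_def by measurable
    show "\<psi> t \<le> 1 / mass_density 1 r * mass_density 1 t" for t
    proof (cases "t \<in> {0<..<r}")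
      case True
      then have "mass_density 1 r \<le> mass_density 1 t" by (intro mass_density_decreasing) auto
      then show ?thesis using True pos by (simp add: \<psi>_def)
    qed (use pos in \<open>simp add: \<psi>_def\<close>)
  qed (use pos in \<open>auto simp: \<psi>_def\<close>)
  then have "ennreal (s powr N) * emeasure m (ball x0 R) = emeasure m (ball x0 r)"
    using int[of s] int[of 1] s r by (simp add: s_def)
  then have "ennreal ((R / r) powr N) * emeasure m (ball x0 r)
     = ennreal ((R / r) powr N * s powr N) * emeasure m (ball x0 R)"
    by (simp add: ennreal_mult mult.assoc)
  also have "(R / r) powr N * s powr N = 1" using r by (simp add: s_def powr_mult[symmetric])
  finally show ?thesis by simp
qed

end

section \<open>The inequality on volume cones\<close>

context mcp_space
begin

lemma cone_emeasure_ball: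
  assumes cone: "\<And>r R. 0 < r \<Longrightarrow> r < R \<Longrightarrow> measure m (ball x0 R) / measure m (ball x0 r) = (R / r) powr N"
    and r: "0 < r"
  shows "emeasure m (ball x0 r) = ennreal (measure m (ball x0 1) * r powr N)"
proof -
  have pos: "0 < measure m (ball x0 t)" if "0 < t" for t
    using emeasure_ball_pos_finite[OF mms that, of x0]
    by (simp add: emeasure_eq_ennreal_measure less_top[symmetric])
  have "measure m (ball x0 r) = measure m (ball x0 1) * r powr N"
  proof (cases r "1::real" rule: linorder_cases)
    case less
    then show ?thesis using cone[of r 1] r pos[of r] pos[of 1] by (simp add: powr_divide field_simps)
  next
    case greater
    then show ?thesis using cone[of 1 r] pos[of 1] by (simp add: field_simps)
  qed simp
  then show ?thesis
    using emeasure_ball_pos_finite[OF mms r, of x0]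
    by (metis emeasure_eq_ennreal_measure infinity_ennreal_def less_irrefl)
qed

end

text \<open>
  A volume cone, normalised by the volume \<open>v\<close> of the unit ball around the vertex.
\<close>
locale mcp_cone = mcp_space +
  fixes x0 :: 'a and v :: real
  assumes v_nonneg: "0 \<le> v"
    and cone_ball: "\<And>r. 0 < r \<Longrightarrow> emeasure m (ball x0 r) = ennreal (v * r powr N)"
begin

lemma cone_no_atom: "emeasure m {x0} = 0"
proof -
  have "emeasure m {x0} \<le> ennreal (v * (1 / real (Suc n)) powr N)" for n
    using emeasure_mono[of "{x0}" "ball x0 (1 / real (Suc n))" m] cone_ball[of "1 / real (Suc n)"] by simp
  moreover have "(\<lambda>n. ennreal (v * (1 / real (Suc n)) powr N)) \<longlonglongrightarrow> ennreal 0"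
    using N_pos by (intro tendsto_ennrealI) real_asymp
  ultimately have "emeasure m {x0} \<le> ennreal 0"
    by (intro LIMSEQ_le_const[of "\<lambda>n. ennreal (v * (1 / real (Suc n)) powr N)"]) auto
  then show ?thesis by simp
qed

lemma cone_AE_dist_pos: "AE x in m. 0 < dist x0 x"
  using cone_no_atom by (intro AE_I[where N = "{x0}"]) auto

text \<open>
  On the annulus \<open>{R / 2 ^ Suc j ..< R / 2 ^ j}\<close> the function is at most \<open>2 powr \<bar>a\<bar>\<close> times its value
  at the outer radius, whatever the sign of \<open>a\<close>, and the volume decays like \<open>2 powr (- N * j)\<close>.
\<close>
lemma cone_inverse_power_integrable:
  assumes a: "a < N" and R: "0 < R"
  shows "(\<integral>\<^sup>+x. ennreal (dist x0 x powr (- a)) * indicator (ball x0 R) x \<partial>m) < \<infinity>"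
proof -
  define A where "A = (\<lambda>j::nat. {x. R / 2 ^ Suc j \<le> dist x0 x \<and> dist x0 x < R / 2 ^ j})"
  have [measurable]: "A j \<in> sets borel" for j unfolding A_def by measurable
  have two: "((2::real) ^ j) powr b = (2 powr b) ^ j" for j b
    by (simp add: powr_realpow[symmetric] powr_powr mult.commute)
  have "(\<integral>\<^sup>+x. ennreal (dist x0 x powr (- a)) * indicator (\<Union>j. A j) x \<partial>m) < \<infinity>"
  proof (rule nn_integral_finite_of_geometric_pieces)
    show "A j \<in> sets m" for j by simp
    show "ennreal (dist x0 x powr (- a)) \<le> ennreal ((R / 2 ^ j) powr (- a) * 2 powr \<bar>a\<bar>)"
      if "x \<in> A j" for x j
    proof (rule ennreal_leI)
      define t where "t = dist x0 x / (R / 2 ^ j)"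
      have t: "1 / 2 \<le> t" "t \<le> 1" using that R by (auto simp: A_def t_def field_simps)
      have "t powr (- a) \<le> 2 powr \<bar>a\<bar>"
      proof (cases "0 \<le> a")
        case True
        have "t powr (- a) \<le> (1 / 2) powr (- a)" using True t by (intro powr_mono2') auto
        then show ?thesis using True by (simp add: powr_divide powr_minus field_simps)
      next
        case False
        have "t powr (- a) \<le> 1 powr (- a)" using False t by (intro powr_mono2) auto
        also have "\<dots> \<le> 2 powr \<bar>a\<bar>" using ge_one_powr_ge_zero[of 2 "\<bar>a\<bar>"] by simp
        finally show ?thesis .
      qed
      then have "(R / 2 ^ j) powr (- a) * t powr (- a) \<le> (R / 2 ^ j) powr (- a) * 2 powr \<bar>a\<bar>"
        by (rule mult_left_mono) simp
      moreover have "dist x0 x powr (- a) = (R / 2 ^ j) powr (- a) * t powr (- a)"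
        using R t by (subst powr_mult[symmetric]) (auto simp: t_def)
      ultimately show "dist x0 x powr (- a) \<le> (R / 2 ^ j) powr (- a) * 2 powr \<bar>a\<bar>" by simp
    qed
    show "ennreal ((R / 2 ^ j) powr (- a) * 2 powr \<bar>a\<bar>) * emeasure m (A j)
        \<le> ennreal (2 powr \<bar>a\<bar> * v * R powr (N - a) * (2 powr (a - N)) ^ j)" for j
    proof -
      have "emeasure m (A j) \<le> emeasure m (ball x0 (R / 2 ^ j))"
        by (rule emeasure_mono) (auto simp: A_def)
      also have "\<dots> = ennreal (v * (R / 2 ^ j) powr N)" using R by (intro cone_ball) simp
      finally have "ennreal ((R / 2 ^ j) powr (- a) * 2 powr \<bar>a\<bar>) * emeasure m (A j)
          \<le> ennreal ((R / 2 ^ j) powr (- a) * 2 powr \<bar>a\<bar>) * ennreal (v * (R / 2 ^ j) powr N)"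
        by (rule mult_left_mono) simp
      also have "\<dots> = ennreal ((R / 2 ^ j) powr (- a) * 2 powr \<bar>a\<bar> * (v * (R / 2 ^ j) powr N))"
        using v_nonneg by (intro ennreal_mult[symmetric]) auto
      also have "(R / 2 ^ j) powr (- a) * 2 powr \<bar>a\<bar> * (v * (R / 2 ^ j) powr N)
          = 2 powr \<bar>a\<bar> * v * (R / 2 ^ j) powr (N - a)"
        by (simp add: powr_add[symmetric])
      also have "(R / 2 ^ j) powr (N - a) = R powr (N - a) * (2 powr (a - N)) ^ j"
      proof -
        have "2 powr (a - N) = 1 / 2 powr (N - a)" using powr_minus_divide[of 2 "N - a"] by simp
        moreover have "(R / 2 ^ j) powr (N - a) = R powr (N - a) / (2 powr (N - a)) ^ j"
          using R by (simp add: powr_divide two)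
        ultimately show ?thesis by (simp add: power_divide)
      qed
      finally show ?thesis by (simp add: mult_ac)
    qed
    show "2 powr (a - N) < 1" using a powr_less_mono[of "a - N" 0 2] by simp
  qed (use v_nonneg in auto)
  moreover have "(\<integral>\<^sup>+x. ennreal (dist x0 x powr (- a)) * indicator (ball x0 R) x \<partial>m)
      \<le> (\<integral>\<^sup>+x. ennreal (dist x0 x powr (- a)) * indicator (\<Union>j. A j) x \<partial>m)"
  proof (rule nn_integral_mono_AE, use cone_AE_dist_pos in eventually_elim)
    fix x assume d: "0 < dist x0 x"
    have "x \<in> (\<Union>j. A j)" if "dist x0 x < R"
    proof -
      have y: "1 < R / dist x0 x" "0 < R / dist x0 x" using that d R by auto
      then have "0 < log 2 (R / dist x0 x)" by simp
      then have "real (nat (\<lceil>log 2 (R / dist x0 x)\<rceil> - 1)) < log 2 (R / dist x0 x)"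
        "log 2 (R / dist x0 x) \<le> real (nat (\<lceil>log 2 (R / dist x0 x)\<rceil> - 1)) + 1" by linarith+
      then obtain j :: nat where j: "real j < log 2 (R / dist x0 x)" "log 2 (R / dist x0 x) \<le> real j + 1"
        by blast
      then have "2 powr real j < R / dist x0 x" "R / dist x0 x \<le> 2 powr (real j + 1)"
        using less_log_iff[of 2 "R / dist x0 x" "real j"] log_le_iff[of 2 "R / dist x0 x" "real j + 1"] y
        by simp_all
      then have "x \<in> A j" using d by (auto simp: A_def powr_add powr_realpow field_simps)
      then show ?thesis by blast
    qed
    then show "ennreal (dist x0 x powr (- a)) * indicator (ball x0 R) x
        \<le> ennreal (dist x0 x powr (- a)) * indicator (\<Union>j. A j) x"
      by (auto split: split_indicator)
  qed
  ultimately show ?thesis by (rule le_less_trans[rotated])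
qed

lemma cone_weighted_eq:
  assumes "0 < b"
  shows "(\<integral>\<^sup>+x. epowr \<bar>u x\<bar> b / epowr (dist x0 x) a \<partial>m)
    = (\<integral>\<^sup>+x. ennreal (\<bar>u x\<bar> powr b * dist x0 x powr (- a)) \<partial>m)"
  by (rule nn_integral_cong_AE, use cone_AE_dist_pos in eventually_elim)
    (rule epowr_divide, use assms in auto)

lemma cone_weighted_finite:
  assumes u: "u \<in> Lip_c" and a: "a < N" and b: "0 < b"
  shows "(\<integral>\<^sup>+x. ennreal (\<bar>u x\<bar> powr b * dist x0 x powr (- a)) \<partial>m) < \<infinity>"
proof -
  obtain L S R where *: "L-lipschitz_on UNIV u" "0 \<le> S" "\<And>x. \<bar>u x\<bar> \<le> S" "0 < R"
    "\<And>x. R \<le> dist x0 x \<Longrightarrow> u x = 0" "\<And>x. R \<le> dist x0 x \<Longrightarrow> loc_lip u x = 0"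
    by (rule Lip_c_bounds[OF u, of x0], rule that)
  have "(\<integral>\<^sup>+x. ennreal (\<bar>u x\<bar> powr b * dist x0 x powr (- a)) \<partial>m)
      \<le> (\<integral>\<^sup>+x. ennreal (S powr b) * (ennreal (dist x0 x powr (- a)) * indicator (ball x0 R) x) \<partial>m)"
  proof (rule nn_integral_mono)
    fix x
    have "\<bar>u x\<bar> powr b * dist x0 x powr (- a) \<le> S powr b * dist x0 x powr (- a)"
      using *(2,3) b by (intro mult_right_mono powr_mono2) auto
    then have "ennreal (\<bar>u x\<bar> powr b * dist x0 x powr (- a)) \<le> ennreal (S powr b * dist x0 x powr (- a))"
      by (rule ennreal_leI)
    then show "ennreal (\<bar>u x\<bar> powr b * dist x0 x powr (- a))
        \<le> ennreal (S powr b) * (ennreal (dist x0 x powr (- a)) * indicator (ball x0 R) x)"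
      using *(5)[of x] by (cases "dist x0 x < R") (auto simp: ennreal_mult)
  qed
  also have "\<dots> = ennreal (S powr b) *
      (\<integral>\<^sup>+x. ennreal (dist x0 x powr (- a)) * indicator (ball x0 R) x \<partial>m)"
  proof (rule nn_integral_cmult)
    have "(\<lambda>x. ennreal (dist x0 x powr (- a))) \<in> borel_measurable borel" by measurable
    then show "(\<lambda>x. ennreal (dist x0 x powr (- a)) * indicator (ball x0 R) x) \<in> borel_measurable m"
      by (intro borel_measurable_m borel_measurable_times_ennreal borel_measurable_indicator) auto
  qed
  also have "\<dots> < \<infinity>"
    using cone_inverse_power_integrable[OF a *(4)] by (simp add: ennreal_mult_less_top)
  finally show ?thesis .
qed

lemma Lip_c_energy_finite:
  assumes u: "u \<in> Lip_c"
  shows "(\<integral>\<^sup>+x. (loc_lip u x)\<^sup>2 \<partial>m) < \<infinity>"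
proof -
  obtain L S R where *: "L-lipschitz_on UNIV u" "0 \<le> S" "\<And>x. \<bar>u x\<bar> \<le> S" "0 < R"
    "\<And>x. R \<le> dist x0 x \<Longrightarrow> u x = 0" "\<And>x. R \<le> dist x0 x \<Longrightarrow> loc_lip u x = 0"
    by (rule Lip_c_bounds[OF u, of x0], rule that)
  have "(\<integral>\<^sup>+x. (loc_lip u x)\<^sup>2 \<partial>m) \<le> (\<integral>\<^sup>+x. (ennreal L)\<^sup>2 * indicator (ball x0 R) x \<partial>m)"
  proof (rule nn_integral_mono)
    fix x
    show "(loc_lip u x)\<^sup>2 \<le> (ennreal L)\<^sup>2 * indicator (ball x0 R) x"
      using *(6)[of x] power_mono[OF loc_lip_le_lipschitz[OF *(1), of x], of 2]
      by (cases "dist x0 x < R") auto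
  qed
  also have "\<dots> = (ennreal L)\<^sup>2 * emeasure m (ball x0 R)"
    by (rule nn_integral_cmult_indicator) simp
  also have "\<dots> < \<infinity>"
    using *(4) by (simp add: cone_ball ennreal_mult_less_top power_less_top_ennreal)
  finally show ?thesis .
qed

lemma cone_CKN_integrals_finite:
  assumes q: "q < 2" and p: "2 < p" and N2: "2 < N"
  shows "CKN_integrals_finite m p q x0"
  unfolding CKN_integrals_finite_def
proof (intro ballI conjI)
  fix u :: "'a \<Rightarrow> real" assume u: "u \<in> Lip_c"
  show "(\<integral>\<^sup>+ x. (loc_lip u x)\<^sup>2 \<partial>m) < \<infinity>" by (rule Lip_c_energy_finite[OF u])
  have "0 < 2 * p - 2" "0 < p" using p by auto
  then show "(\<integral>\<^sup>+ x. epowr \<bar>u x\<bar> (2 * p - 2) / epowr (dist x0 x) (2 * q - 2) \<partial>m) < \<infinity>"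
    "(\<integral>\<^sup>+ x. epowr \<bar>u x\<bar> p / epowr (dist x0 x) q \<partial>m) < \<infinity>"
    using cone_weighted_finite[OF u, of "2 * q - 2" "2 * p - 2"] cone_weighted_finite[OF u, of q p] q N2
    by (simp_all add: cone_weighted_eq)
qed

text \<open>
  The transported measure lies below the restriction of \<open>m\<close> to the smaller ball, and on a cone both
  have total mass \<open>v * (s * R) powr N\<close>. Applying the bound to a set and to its complement shows that
  they agree.
\<close>
lemma cone_plan_transport:
  assumes \<pi>: "contraction_plan x0 R \<pi>" and R: "0 < R" and s: "0 < s" "s \<le> 1"
    and f: "f \<in> borel_measurable borel"
  shows "ennreal (s powr N) * (\<integral>\<^sup>+\<gamma>. f (\<gamma> (1 - s)) \<partial>\<pi>)
    = (\<integral>\<^sup>+x. f x * indicator (ball x0 (s * R)) x \<partial>m)"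
proof -
  let ?B = "ball x0 (s * R)" and ?e = "\<lambda>\<gamma>. \<gamma> (1 - s) :: 'a" and ?c = "ennreal (s powr N)"
  have e0: "(\<lambda>\<gamma>. \<gamma> 0) \<in> borel_measurable \<pi>" and es: "?e \<in> borel_measurable \<pi>"
    using s by (auto intro!: contraction_plan_measurable[OF \<pi>])
  have "(\<integral>\<^sup>+\<gamma>. indicator (- ball x0 R) (\<gamma> 0) \<partial>\<pi>) = (\<integral>\<^sup>+x. indicator (- ball x0 R) x * indicator (ball x0 R) x \<partial>m)"
    by (rule contraction_plan_start[OF \<pi>]) (auto intro!: borel_measurable_indicator)
  also have "\<dots> = 0" by (auto intro!: nn_integral_zero' AE_I2 simp: indicator_def)
  finally have "AE \<gamma> in \<pi>. indicator (- ball x0 R) (\<gamma> 0) = (0::ennreal)"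
    by (subst (asm) nn_integral_0_iff_AE)
       (auto intro!: measurable_compose[OF e0] borel_measurable_indicator)
  moreover have "AE \<gamma> in \<pi>. dist x0 (?e \<gamma>) = s * dist x0 (\<gamma> 0)"
    using contraction_plan_AE[OF \<pi>, of s] s by (auto elim: eventually_mono)
  ultimately have in_ball: "AE \<gamma> in \<pi>. ?e \<gamma> \<in> ?B"
    by eventually_elim (use s in \<open>auto simp: indicator_eq_0_iff\<close>)
  have le: "?c * (\<integral>\<^sup>+\<gamma>. g (?e \<gamma>) \<partial>\<pi>) \<le> (\<integral>\<^sup>+x. g x * indicator ?B x \<partial>m)"
    if g: "g \<in> borel_measurable borel" for g
  proof -
    have "(\<integral>\<^sup>+\<gamma>. g (?e \<gamma>) \<partial>\<pi>) = (\<integral>\<^sup>+\<gamma>. g (?e \<gamma>) * indicator ?B (?e \<gamma>) \<partial>\<pi>)"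
      by (rule nn_integral_cong_AE, use in_ball in eventually_elim) simp
    moreover have "(\<lambda>x. g x * indicator ?B x) \<in> borel_measurable borel"
      using g by (intro borel_measurable_times_ennreal borel_measurable_indicator) auto
    ultimately show ?thesis
      using contraction_plan_le[OF \<pi>, of "\<lambda>x. g x * indicator ?B x" s] s by simp
  qed
  define \<rho> where "\<rho> = scale_measure ?c (distr \<pi> borel ?e)"
  have \<rho>: "emeasure \<rho> S = ?c * (\<integral>\<^sup>+\<gamma>. indicator S (?e \<gamma>) \<partial>\<pi>)" if S: "S \<in> sets borel" for S
  proof -
    have "emeasure \<rho> S = ?c * (\<integral>\<^sup>+x. indicator S x \<partial>distr \<pi> borel ?e)" using S by (simp add: \<rho>_def)
    also have "(\<integral>\<^sup>+x. indicator S x \<partial>distr \<pi> borel ?e) = (\<integral>\<^sup>+\<gamma>. indicator S (?e \<gamma>) \<partial>\<pi>)"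
      using S es by (intro nn_integral_distr) auto
    finally show ?thesis .
  qed
  define \<tau> where "\<tau> = density m (indicator ?B)"
  have \<tau>: "nn_integral \<tau> g = (\<integral>\<^sup>+x. g x * indicator ?B x \<partial>m)" if "g \<in> borel_measurable borel" for g
    using that unfolding \<tau>_def
    by (subst nn_integral_density) (auto simp: mult.commute intro!: borel_measurable_m borel_measurable_indicator)
  have \<tau>_set: "emeasure \<tau> S = (\<integral>\<^sup>+x. indicator S x * indicator ?B x \<partial>m)" if "S \<in> sets borel" for S
    using \<tau>[of "indicator S"] that by (simp add: \<tau>_def)
  have sets: "sets \<rho> = sets borel" "sets \<tau> = sets borel" by (simp_all add: \<rho>_def \<tau>_def)
  have space: "space \<rho> = UNIV" "space \<tau> = UNIV"
    using sets_eq_imp_space_eq[OF sets(1)] sets_eq_imp_space_eq[OF sets(2)] by auto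
  have "(\<integral>\<^sup>+\<gamma>. 1 \<partial>\<pi>) = emeasure m (ball x0 R)"
    using contraction_plan_start[OF \<pi>, of "\<lambda>_. 1"] by simp
  then have "emeasure \<rho> UNIV = ?c * ennreal (v * R powr N)"
    using R by (subst \<rho>) (auto simp: cone_ball)
  also have "\<dots> = ennreal (v * (s * R) powr N)"
    using v_nonneg R s by (simp add: ennreal_mult[symmetric] powr_mult mult_ac)
  also have "\<dots> = emeasure \<tau> UNIV"
    using R s by (subst \<tau>_set) (auto simp: cone_ball)
  finally have total: "emeasure \<rho> UNIV = emeasure \<tau> UNIV" .
  have fin: "emeasure \<tau> UNIV < \<top>"
    using R s by (subst \<tau>_set) (auto simp: cone_ball)
  have "\<rho> = \<tau>"
  proof (rule measure_eqI)
    show "sets \<rho> = sets \<tau>" by (simp add: sets)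
    fix S assume "S \<in> sets \<rho>"
    then have S: "S \<in> sets borel" "- S \<in> sets borel" by (auto simp: sets)
    have le1: "emeasure \<rho> S \<le> emeasure \<tau> S" "emeasure \<rho> (- S) \<le> emeasure \<tau> (- S)"
      using le[of "indicator S"] le[of "indicator (- S)"] S by (auto simp: \<rho> \<tau>_set)
    have "emeasure \<tau> (- S) + emeasure \<tau> S = emeasure \<tau> UNIV"
      using S by (subst plus_emeasure) (auto simp: sets Compl_partition2)
    also have "\<dots> = emeasure \<rho> (- S) + emeasure \<rho> S"
      unfolding total[symmetric] using S by (subst plus_emeasure) (auto simp: sets Compl_partition2)
    also have "\<dots> \<le> emeasure \<tau> (- S) + emeasure \<rho> S" using le1 by (intro add_right_mono)
    finally have "emeasure \<tau> S \<le> emeasure \<rho> S \<or> emeasure \<tau> (- S) = \<top>"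
      by (auto simp: ennreal_add_left_cancel_le)
    moreover have "emeasure \<tau> (- S) \<le> emeasure \<tau> UNIV" by (rule emeasure_mono) (auto simp: sets)
    ultimately show "emeasure \<rho> S = emeasure \<tau> S" using le1 fin by (auto simp: top_unique)
  qed
  then have "nn_integral \<rho> f = nn_integral \<tau> f" by simp
  moreover have "nn_integral \<rho> f = ?c * (\<integral>\<^sup>+\<gamma>. f (?e \<gamma>) \<partial>\<pi>)"
    using f es unfolding \<rho>_def
    by (subst nn_integral_scale_measure) (auto simp: nn_integral_distr)
  ultimately show ?thesis by (simp add: \<tau>[OF f])
qed

text \<open>
  The weight is homogeneous along the geodesics, so only \<open>w\<close> is evaluated at the transported point.
\<close>
lemma cone_plan_homogeneous:
  fixes w :: "'a \<Rightarrow> real"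
  assumes \<pi>: "contraction_plan x0 R \<pi>" and R: "0 < R" and s: "0 < s" "s \<le> 1"
    and w: "w \<in> borel_measurable borel" "\<And>x. 0 \<le> w x"
    and supp: "\<And>x. s * R \<le> dist x0 x \<Longrightarrow> w x = 0"
  shows "(\<integral>\<^sup>+x. ennreal (w x * dist x0 x powr b) \<partial>m)
    = ennreal (s powr (N + b)) * (\<integral>\<^sup>+\<gamma>. ennreal (w (\<gamma> (1 - s)) * dist x0 (\<gamma> 0) powr b) \<partial>\<pi>)"
proof -
  note [measurable] = w(1)
  have e0: "(\<lambda>\<gamma>. \<gamma> 0) \<in> borel_measurable \<pi>" and es: "(\<lambda>\<gamma>. \<gamma> (1 - s)) \<in> borel_measurable \<pi>"
    using s by (auto intro!: contraction_plan_measurable[OF \<pi>])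
  have "(\<integral>\<^sup>+x. ennreal (w x * dist x0 x powr b) \<partial>m)
      = (\<integral>\<^sup>+x. ennreal (w x * dist x0 x powr b) * indicator (ball x0 (s * R)) x \<partial>m)"
    using supp by (intro nn_integral_cong) (auto split: split_indicator)
  also have "\<dots> = ennreal (s powr N) * (\<integral>\<^sup>+\<gamma>. ennreal (w (\<gamma> (1 - s)) * dist x0 (\<gamma> (1 - s)) powr b) \<partial>\<pi>)"
    by (rule cone_plan_transport[OF \<pi> R s, symmetric]) measurable
  also have "(\<integral>\<^sup>+\<gamma>. ennreal (w (\<gamma> (1 - s)) * dist x0 (\<gamma> (1 - s)) powr b) \<partial>\<pi>)
      = (\<integral>\<^sup>+\<gamma>. ennreal (s powr b) * ennreal (w (\<gamma> (1 - s)) * dist x0 (\<gamma> 0) powr b) \<partial>\<pi>)"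
  proof (rule nn_integral_cong_AE)
    have "AE \<gamma> in \<pi>. dist x0 (\<gamma> (1 - s)) = s * dist x0 (\<gamma> 0)"
      using contraction_plan_AE[OF \<pi>, of s] s by (auto elim: eventually_mono)
    then show "AE \<gamma> in \<pi>. ennreal (w (\<gamma> (1 - s)) * dist x0 (\<gamma> (1 - s)) powr b)
        = ennreal (s powr b) * ennreal (w (\<gamma> (1 - s)) * dist x0 (\<gamma> 0) powr b)"
    proof eventually_elim
      case (elim \<gamma>)
      have eq: "w (\<gamma> (1 - s)) * dist x0 (\<gamma> (1 - s)) powr b = s powr b * (w (\<gamma> (1 - s)) * dist x0 (\<gamma> 0) powr b)"
        unfolding elim using s by (simp add: powr_mult)
      show ?case unfolding eq by (intro ennreal_mult mult_nonneg_nonneg w(2)) auto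
    qed
  qed
  also have "\<dots> = ennreal (s powr b) * (\<integral>\<^sup>+\<gamma>. ennreal (w (\<gamma> (1 - s)) * dist x0 (\<gamma> 0) powr b) \<partial>\<pi>)"
  proof -
    have "(\<lambda>x. dist x0 x powr b) \<in> borel_measurable borel" by measurable
    from measurable_compose[OF e0 this] show ?thesis
      by (intro nn_integral_cmult measurable_compose[OF _ measurable_ennreal] borel_measurable_times
        measurable_compose[OF es w(1)])
  qed
  finally show ?thesis by (simp add: powr_add ennreal_mult mult.assoc)
qed

lemma plan_AE_start_pos:
  assumes \<pi>: "contraction_plan x0 R \<pi>"
  shows "AE \<gamma> in \<pi>. 0 < dist x0 (\<gamma> 0)"
proof -
  have e0: "(\<lambda>\<gamma>. \<gamma> 0) \<in> borel_measurable \<pi>" by (rule contraction_plan_measurable[OF \<pi>]) simp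
  have "(\<integral>\<^sup>+\<gamma>. indicator {x0} (\<gamma> 0) \<partial>\<pi>) = (\<integral>\<^sup>+x. indicator {x0} x * indicator (ball x0 R) x \<partial>m)"
    by (rule contraction_plan_start[OF \<pi>]) (auto intro!: borel_measurable_indicator)
  also have "\<dots> \<le> (\<integral>\<^sup>+x. indicator {x0} x \<partial>m)"
    by (intro nn_integral_mono) (auto split: split_indicator)
  also have "\<dots> = 0" using cone_no_atom by simp
  finally have "(\<integral>\<^sup>+\<gamma>. indicator {x0} (\<gamma> 0) \<partial>\<pi>) = 0" by simp
  then have "AE \<gamma> in \<pi>. indicator {x0} (\<gamma> 0) = (0::ennreal)"
    by (subst (asm) nn_integral_0_iff_AE)
       (auto intro!: measurable_compose[OF e0] borel_measurable_indicator)
  then show ?thesis by eventually_elim (auto simp: indicator_eq_0_iff)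
qed

text \<open>
  The energy of \<open>u\<close> with slopes replaced by difference quotients along the geodesics of the plan.
\<close>
definition plan_quotient_energy :: "('a \<Rightarrow> real) \<Rightarrow> (real \<Rightarrow> 'a) measure \<Rightarrow> real \<Rightarrow> ennreal" where
  "plan_quotient_energy u \<pi> s =
     (\<integral>\<^sup>+\<gamma>. ennreal ((\<bar>u (\<gamma> (1 - s)) - u (\<gamma> 0)\<bar> / dist (\<gamma> 0) (\<gamma> (1 - s)))\<^sup>2) \<partial>\<pi>)"

text \<open>
  With \<open>a = \<bar>u (\<gamma> (1 - s))\<bar>\<close> and \<open>b = \<bar>u (\<gamma> 0)\<bar>\<close>, the tangent inequality for
  the power bounds \<open>a powr p - b powr p\<close> by \<open>p * a powr (p - 1) * \<bar>a - b\<bar>\<close>. The base point of the tangent is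
  the transported one: after Cauchy--Schwarz, the factor with \<open>a powr (2 * p - 2)\<close> is then
  again given exactly by the change of variables. The outer radius \<open>2 * R\<close> leaves room for
  \<open>s \<ge> 1 / 2\<close>, for which the support of \<open>u\<close> is still covered by the contracted ball.
\<close>
lemma plan_inequality:
  fixes p q :: real
  assumes \<pi>: "contraction_plan x0 (2 * R) \<pi>" and R: "0 < R" and s: "1 / 2 \<le> s" "s < 1" and p: "2 < p"
    and u: "continuous_on UNIV u" and supp: "\<And>x. R \<le> dist x0 x \<Longrightarrow> u x = 0"
    and J: "(\<integral>\<^sup>+x. ennreal (\<bar>u x\<bar> powr p * dist x0 x powr (- q)) \<partial>m) = ennreal j" "0 \<le> j"
    and W: "(\<integral>\<^sup>+x. ennreal (\<bar>u x\<bar> powr (2 * p - 2) * dist x0 x powr (- (2 * q - 2))) \<partial>m) = ennreal w" "0 \<le> w"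
    and Q: "plan_quotient_energy u \<pi> s = ennreal Q" "0 \<le> Q"
    and Nq: "0 < N - q"
  shows "((s powr (- (N - q)) - 1) / (1 - s))\<^sup>2 * j\<^sup>2 \<le> p\<^sup>2 * (s powr (- (N - (2 * q - 2))) * w) * Q"
proof -
  have s01: "0 < s" "s \<le> 1" using s by auto
  have um: "u \<in> borel_measurable borel" using u by (rule borel_measurable_continuous_onI)
  note [measurable] = um
  have e0 [measurable]: "(\<lambda>\<gamma>. \<gamma> 0) \<in> borel_measurable \<pi>"
    and es [measurable]: "(\<lambda>\<gamma>. \<gamma> (1 - s)) \<in> borel_measurable \<pi>"
    using s by (auto intro!: contraction_plan_measurable[OF \<pi>])
  have u0: "(\<lambda>\<gamma>. u (\<gamma> 0)) \<in> borel_measurable \<pi>" and us: "(\<lambda>\<gamma>. u (\<gamma> (1 - s))) \<in> borel_measurable \<pi>"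
    by (rule measurable_compose[OF e0 um], rule measurable_compose[OF es um])
  have d0: "(\<lambda>\<gamma>. dist x0 (\<gamma> 0)) \<in> borel_measurable \<pi>" 
    and ds: "(\<lambda>\<gamma>. dist (\<gamma> 0) (\<gamma> (1 - s))) \<in> borel_measurable \<pi>"
    using e0 es by (auto intro!: borel_measurable_dist)
  define D where "D = (\<lambda>\<gamma>. \<bar>u (\<gamma> (1 - s)) - u (\<gamma> 0)\<bar> / dist (\<gamma> 0) (\<gamma> (1 - s)))"
  define V where "V = (\<lambda>\<gamma>. \<bar>u (\<gamma> (1 - s))\<bar> powr (p - 1) * dist x0 (\<gamma> 0) powr (1 - q))"
  have Dm: "D \<in> borel_measurable \<pi>" and Vm: "V \<in> borel_measurable \<pi>"
    unfolding D_def V_def using u0 us d0 ds by measurable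
  have hom: "(\<integral>\<^sup>+x. ennreal (\<bar>u x\<bar> powr c * dist x0 x powr b) \<partial>m)
    = ennreal (t powr (N + b)) * (\<integral>\<^sup>+\<gamma>. ennreal (\<bar>u (\<gamma> (1 - t))\<bar> powr c * dist x0 (\<gamma> 0) powr b) \<partial>\<pi>)"
    if t: "1 / 2 \<le> t" "t \<le> 1" and c: "0 < c" for t b c
  proof (rule cone_plan_homogeneous[OF \<pi>])
    show "\<bar>u x\<bar> powr c = 0" if "t * (2 * R) \<le> dist x0 x" for x
    proof -
      have "1 / 2 * (2 * R) \<le> t * (2 * R)" using t R by (intro mult_right_mono) auto
      then show ?thesis using that c by (simp add: supp)
    qed
  qed (use t R in auto)
  have cancel: "(\<integral>\<^sup>+\<gamma>. f \<gamma> \<partial>\<pi>) = ennreal (s powr (- b) * z)"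
    if "ennreal z = ennreal (s powr b) * (\<integral>\<^sup>+\<gamma>. f \<gamma> \<partial>\<pi>)" "0 \<le> z" for f b z
  proof -
    have "ennreal (s powr (- b) * z) = ennreal (s powr (- b)) * (ennreal (s powr b) * (\<integral>\<^sup>+\<gamma>. f \<gamma> \<partial>\<pi>))"
      using that by (simp add: ennreal_mult)
    also have "\<dots> = ennreal (s powr (- b) * s powr b) * (\<integral>\<^sup>+\<gamma>. f \<gamma> \<partial>\<pi>)"
      by (simp add: ennreal_mult mult.assoc)
    also have "s powr (- b) * s powr b = 1" using s01 by (simp add: powr_add[symmetric])
    finally show ?thesis by simp
  qed
  have A: "(\<integral>\<^sup>+\<gamma>. ennreal (\<bar>u (\<gamma> (1 - s))\<bar> powr p * dist x0 (\<gamma> 0) powr (- q)) \<partial>\<pi>)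
      = ennreal (s powr (- (N - q)) * j)"
    using hom[of s p "- q"] s p J by (intro cancel) auto
  have A0: "(\<integral>\<^sup>+\<gamma>. ennreal (\<bar>u (\<gamma> 0)\<bar> powr p * dist x0 (\<gamma> 0) powr (- q)) \<partial>\<pi>) = ennreal j"
    using hom[of 1 p "- q"] p J by simp
  have B: "(\<integral>\<^sup>+\<gamma>. ennreal (\<bar>u (\<gamma> (1 - s))\<bar> powr (2 * p - 2) * dist x0 (\<gamma> 0) powr (- (2 * q - 2))) \<partial>\<pi>)
      = ennreal (s powr (- (N - (2 * q - 2))) * w)"
  proof -
    have "N + - (2 * q - 2) = N - (2 * q - 2)" by simp
    from hom[of s "2 * p - 2" "- (2 * q - 2)", unfolded this W(1)] show ?thesis
      using s p W(2) by (intro cancel) auto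
  qed
  have sq: "(x powr y)\<^sup>2 = x powr (2 * y)" for x y :: real
    by (cases "x = 0") (auto simp: powr_def power2_eq_square mult_exp_exp)
  have "(V \<gamma>)\<^sup>2 = \<bar>u (\<gamma> (1 - s))\<bar> powr (2 * p - 2) * dist x0 (\<gamma> 0) powr (- (2 * q - 2))" for \<gamma>
    unfolding V_def power_mult_distrib sq by (simp add: right_diff_distrib)
  then have V2: "(\<integral>\<^sup>+\<gamma>. (ennreal (V \<gamma>))\<^sup>2 \<partial>\<pi>) = ennreal (s powr (- (N - (2 * q - 2))) * w)"
    using B by (simp add: ennreal_power V_def)
  have D2: "(\<integral>\<^sup>+\<gamma>. (ennreal (D \<gamma>))\<^sup>2 \<partial>\<pi>) = ennreal Q"
    using Q(1) by (simp add: ennreal_power D_def plan_quotient_energy_def)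
  have "(\<integral>\<^sup>+\<gamma>. ennreal (V \<gamma>) * ennreal (D \<gamma>) \<partial>\<pi>)\<^sup>2 \<le> ennreal (s powr (- (N - (2 * q - 2))) * w) * ennreal Q"
    unfolding V2[symmetric] D2[symmetric]
    by (rule Cauchy_Schwarz_nn_integral) (use Vm Dm in auto)
  then have X2: "(\<integral>\<^sup>+\<gamma>. ennreal (V \<gamma>) * ennreal (D \<gamma>) \<partial>\<pi>)\<^sup>2 \<le> ennreal (s powr (- (N - (2 * q - 2))) * w * Q)"
    using W Q by (simp add: ennreal_mult)
  then have "(\<integral>\<^sup>+\<gamma>. ennreal (V \<gamma>) * ennreal (D \<gamma>) \<partial>\<pi>) \<noteq> \<top>"
    by (auto simp: top_unique power2_eq_square ennreal_mult_top)
  then obtain X where X: "(\<integral>\<^sup>+\<gamma>. ennreal (V \<gamma>) * ennreal (D \<gamma>) \<partial>\<pi>) = ennreal X" "0 \<le> X"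
    by (metis ennreal_cases)
  have XX: "X\<^sup>2 \<le> s powr (- (N - (2 * q - 2))) * w * Q"
    using X2 X W Q by (simp add: ennreal_power)
  have plan_dist: "AE \<gamma> in \<pi>. dist x0 (\<gamma> (1 - s)) = s * dist x0 (\<gamma> 0) \<and>
      dist (\<gamma> 0) (\<gamma> (1 - s)) = (1 - s) * dist x0 (\<gamma> 0)"
    using s01 by (intro contraction_plan_AE[OF \<pi>]) auto
  have "AE \<gamma> in \<pi>. ennreal (\<bar>u (\<gamma> (1 - s))\<bar> powr p * dist x0 (\<gamma> 0) powr (- q))
      \<le> ennreal (\<bar>u (\<gamma> 0)\<bar> powr p * dist x0 (\<gamma> 0) powr (- q)) + ennreal (p * (1 - s)) * (ennreal (V \<gamma>) * ennreal (D \<gamma>))"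
    using plan_dist plan_AE_start_pos[OF \<pi>]
  proof eventually_elim
    case (elim \<gamma>)
    let ?a = "\<bar>u (\<gamma> (1 - s))\<bar>" and ?b = "\<bar>u (\<gamma> 0)\<bar>" and ?d = "dist x0 (\<gamma> 0)"
    have dd: "dist (\<gamma> 0) (\<gamma> (1 - s)) = (1 - s) * ?d" using elim s01 by auto
    have "?a powr p \<le> ?b powr p + p * ?a powr (p - 1) * \<bar>?a - ?b\<bar>"
      by (rule powr_diff_le_tangent) (use p in auto)
    also have "\<dots> \<le> ?b powr p + p * ?a powr (p - 1) * \<bar>u (\<gamma> (1 - s)) - u (\<gamma> 0)\<bar>"
      using p by (intro add_left_mono mult_left_mono) auto
    finally have "?a powr p * ?d powr (- q)
        \<le> (?b powr p + p * ?a powr (p - 1) * \<bar>u (\<gamma> (1 - s)) - u (\<gamma> 0)\<bar>) * ?d powr (- q)"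
      by (rule mult_right_mono) simp
    also have "\<dots> = ?b powr p * ?d powr (- q) + p * (1 - s) * (V \<gamma> * D \<gamma>)"
    proof -
      have "?d powr (1 - q) = ?d powr (- q) * ?d" using elim by (simp add: powr_add[of _ "- q" 1, simplified])
      then show ?thesis unfolding V_def D_def dd using elim s by (simp add: field_simps)
    qed
    finally have "ennreal (?a powr p * ?d powr (- q))
        \<le> ennreal (?b powr p * ?d powr (- q) + p * (1 - s) * (V \<gamma> * D \<gamma>))"
      by (rule ennreal_leI)
    also have "\<dots> = ennreal (?b powr p * ?d powr (- q)) + ennreal (p * (1 - s)) * (ennreal (V \<gamma>) * ennreal (D \<gamma>))"
    proof -
      have add_mult: "ennreal (x + c * (y * z)) = ennreal x + ennreal c * (ennreal y * ennreal z)"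
        if "0 \<le> x" "0 \<le> c" "0 \<le> y" "0 \<le> z" for x c y z
        using that by (simp add: ennreal_mult)
      show ?thesis by (rule add_mult) (use p s in \<open>auto simp: V_def D_def\<close>)
    qed
    finally show ?case .
  qed
  then have "(\<integral>\<^sup>+\<gamma>. ennreal (\<bar>u (\<gamma> (1 - s))\<bar> powr p * dist x0 (\<gamma> 0) powr (- q)) \<partial>\<pi>)
    \<le> (\<integral>\<^sup>+\<gamma>. ennreal (\<bar>u (\<gamma> 0)\<bar> powr p * dist x0 (\<gamma> 0) powr (- q))
        + ennreal (p * (1 - s)) * (ennreal (V \<gamma>) * ennreal (D \<gamma>)) \<partial>\<pi>)"
    by (rule nn_integral_mono_AE)
  also have "\<dots> = ennreal j + ennreal (p * (1 - s)) * ennreal X"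
  proof -
    have "(\<lambda>\<gamma>. ennreal (\<bar>u (\<gamma> 0)\<bar> powr p * dist x0 (\<gamma> 0) powr (- q))) \<in> borel_measurable \<pi>"
      using u0 d0 by measurable
    moreover have "(\<lambda>\<gamma>. ennreal (V \<gamma>) * ennreal (D \<gamma>)) \<in> borel_measurable \<pi>"
      using Vm Dm by measurable
    ultimately show ?thesis by (simp add: nn_integral_add nn_integral_cmult A0 X)
  qed
  finally have "ennreal (s powr (- (N - q)) * j) \<le> ennreal (j + p * (1 - s) * X)"
    unfolding A using J X p s by (simp add: ennreal_mult)
  then have "s powr (- (N - q)) * j \<le> j + p * (1 - s) * X"
    using J X p s by (subst (asm) ennreal_le_iff) auto
  then have "(s powr (- (N - q)) - 1) / (1 - s) * j \<le> p * X"
    using s by (simp add: field_simps)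
  moreover have "1 \<le> s powr (- (N - q))"
    using powr_mono'[of "- (N - q)" 0 s] s01 Nq by simp
  then have "0 \<le> (s powr (- (N - q)) - 1) / (1 - s) * j" using s J by simp
  ultimately have "((s powr (- (N - q)) - 1) / (1 - s) * j)\<^sup>2 \<le> (p * X)\<^sup>2"
    by (rule power_mono)
  also have "\<dots> \<le> p\<^sup>2 * (s powr (- (N - (2 * q - 2))) * w * Q)"
    unfolding power_mult_distrib using XX by (rule mult_left_mono) simp
  finally show ?thesis by (simp only: power_mult_distrib mult.assoc)
qed

lemma contraction_plan_const:
  assumes "contraction_plan x0 R \<pi>"
  shows "(\<integral>\<^sup>+\<gamma>. c \<partial>\<pi>) = c * emeasure m (ball x0 R)"
  using contraction_plan_start[OF assms, of "\<lambda>_. c"] by (simp add: nn_integral_cmult_indicator)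

lemma plan_quotient_energy_le:
  assumes "contraction_plan x0 R \<pi>" and L: "L-lipschitz_on UNIV u"
  shows "plan_quotient_energy u \<pi> s \<le> ennreal (L\<^sup>2) * emeasure m (ball x0 R)"
  unfolding plan_quotient_energy_def contraction_plan_const[OF assms(1), symmetric]
  by (intro nn_integral_mono ennreal_leI lipschitz_difference_quotient_square[OF L])

text \<open>
  The reverse Fatou lemma, with the Lipschitz constant as the dominating function.
\<close>
lemma limsup_plan_quotient_energy:
  assumes \<pi>: "contraction_plan x0 R \<pi>" and R: "0 < R" and L: "L-lipschitz_on UNIV u"
  shows "limsup (\<lambda>n. plan_quotient_energy u \<pi> (1 - 1 / real (n + 2))) \<le> (\<integral>\<^sup>+x. (loc_lip u x)\<^sup>2 \<partial>m)"
proof -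
  define \<sigma> where "\<sigma> = (\<lambda>n::nat. 1 - 1 / real (n + 2))"
  have \<sigma>1: "1 - \<sigma> n = 1 / real (n + 2)" for n by (simp add: \<sigma>_def)
  have \<sigma>01: "\<sigma> n \<in> {0..1}" "\<sigma> n < 1" for n by (auto simp: \<sigma>_def field_simps)
  have um: "u \<in> borel_measurable borel"
    using lipschitz_on_continuous_on[OF L] by (rule borel_measurable_continuous_onI)
  have e0: "(\<lambda>\<gamma>. \<gamma> 0) \<in> borel_measurable \<pi>"
    and es: "(\<lambda>\<gamma>. \<gamma> (1 - \<sigma> n)) \<in> borel_measurable \<pi>" for n
    using \<sigma>01[of n] by (auto intro!: contraction_plan_measurable[OF \<pi>])
  let ?q = "\<lambda>n \<gamma>. ennreal ((\<bar>u (\<gamma> (1 - \<sigma> n)) - u (\<gamma> 0)\<bar> / dist (\<gamma> 0) (\<gamma> (1 - \<sigma> n)))\<^sup>2)"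
  have "limsup (\<lambda>n. plan_quotient_energy u \<pi> (\<sigma> n)) \<le> (\<integral>\<^sup>+\<gamma>. limsup (\<lambda>n. ?q n \<gamma>) \<partial>\<pi>)"
    unfolding plan_quotient_energy_def
  proof (rule nn_integral_limsup)
    show "?q n \<in> borel_measurable \<pi>" for n
    proof -
      have "(\<lambda>\<gamma>. dist (\<gamma> 0) (\<gamma> (1 - \<sigma> n))) \<in> borel_measurable \<pi>"
        by (rule borel_measurable_dist[OF e0 es])
      then show ?thesis using measurable_compose[OF e0 um] measurable_compose[OF es um, of n] by measurable
    qed
    show "(\<lambda>\<gamma>. ennreal (L\<^sup>2)) \<in> borel_measurable \<pi>" by simp
    show "AE \<gamma> in \<pi>. ?q n \<gamma> \<le> ennreal (L\<^sup>2)" for n by (intro AE_I2 ennreal_leI lipschitz_difference_quotient_square[OF L])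
    show "(\<integral>\<^sup>+\<gamma>. ennreal (L\<^sup>2) \<partial>\<pi>) < \<infinity>"
      unfolding contraction_plan_const[OF \<pi>] using R by (simp add: cone_ball ennreal_mult_less_top)
  qed
  also have "\<dots> \<le> (\<integral>\<^sup>+\<gamma>. (loc_lip u (\<gamma> 0))\<^sup>2 \<partial>\<pi>)"
  proof (rule nn_integral_mono_AE)
    have "AE \<gamma> in \<pi>. \<forall>n. dist (\<gamma> 0) (\<gamma> (1 - \<sigma> n)) = (1 - \<sigma> n) * dist x0 (\<gamma> 0)"
      unfolding AE_all_countable
      using contraction_plan_AE[OF \<pi> \<sigma>01(1)] by (auto elim: eventually_mono)
    then show "AE \<gamma> in \<pi>. limsup (\<lambda>n. ?q n \<gamma>) \<le> (loc_lip u (\<gamma> 0))\<^sup>2"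
      using plan_AE_start_pos[OF \<pi>]
    proof eventually_elim
      case (elim \<gamma>)
      show ?case
      proof (rule limsup_difference_quotient_le_loc_lip[OF L])
        have "(\<lambda>n. 1 / real (n + 2) * dist x0 (\<gamma> 0)) \<longlonglongrightarrow> 0" by real_asymp
        moreover have "dist (\<gamma> (1 - \<sigma> n)) (\<gamma> 0) = 1 / real (n + 2) * dist x0 (\<gamma> 0)" for n
        proof -
          have "dist (\<gamma> (1 - \<sigma> n)) (\<gamma> 0) = (1 - \<sigma> n) * dist x0 (\<gamma> 0)"
            using elim(1) dist_commute by metis
          also have "\<dots> = 1 / real (n + 2) * dist x0 (\<gamma> 0)" by (simp only: \<sigma>1)
          finally show ?thesis .
        qed
        ultimately have "(\<lambda>n. dist (\<gamma> (1 - \<sigma> n)) (\<gamma> 0)) \<longlonglongrightarrow> 0" by (simp only:)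
        then show "(\<lambda>n. \<gamma> (1 - \<sigma> n)) \<longlonglongrightarrow> \<gamma> 0" by (subst tendsto_dist_iff)
        show "\<gamma> (1 - \<sigma> n) \<noteq> \<gamma> 0" for n
        proof -
          have "dist (\<gamma> 0) (\<gamma> (1 - \<sigma> n)) = (1 - \<sigma> n) * dist x0 (\<gamma> 0)" using elim(1) by blast
          also have "0 < \<dots>" using elim(2) \<sigma>01(2)[of n] by (intro mult_pos_pos) simp_all
          finally show ?thesis by auto
        qed
      qed
    qed
  qed
  also have "\<dots> = (\<integral>\<^sup>+x. (loc_lip u x)\<^sup>2 * indicator (ball x0 R) x \<partial>m)"
    using loc_lip_measurable[OF lipschitz_on_continuous_on[OF L]]
    by (intro contraction_plan_start[OF \<pi>]) measurable
  also have "\<dots> \<le> (\<integral>\<^sup>+x. (loc_lip u x)\<^sup>2 \<partial>m)"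
    by (intro nn_integral_mono) (auto split: split_indicator)
  finally show ?thesis by (simp only: \<sigma>_def)
qed

text \<open>
  The limit \<open>s \<rightarrow> 1\<close> in \<open>plan_inequality\<close>.
\<close>
lemma cone_CKN_inequality:
  assumes q: "0 < q" "q < 2" and p: "2 < p" and N2: "2 < N"
  shows "CKN_inequality m p q x0 ((N - q)\<^sup>2 / p\<^sup>2)"
  unfolding CKN_inequality_def
proof
  fix u :: "'a \<Rightarrow> real" assume u: "u \<in> Lip_c"
  obtain L S R where *: "L-lipschitz_on UNIV u" "0 \<le> S" "\<And>x. \<bar>u x\<bar> \<le> S" "0 < R"
    "\<And>x. R \<le> dist x0 x \<Longrightarrow> u x = 0" "\<And>x. R \<le> dist x0 x \<Longrightarrow> loc_lip u x = 0"
    by (rule Lip_c_bounds[OF u, of x0], rule that)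
  have "0 < 2 * R" using *(4) by simp
  then obtain \<pi> where \<pi>: "contraction_plan x0 (2 * R) \<pi>" using contraction_plan_exists by blast
  define J where "J = (\<integral>\<^sup>+x. ennreal (\<bar>u x\<bar> powr p * dist x0 x powr (- q)) \<partial>m)"
  define W where "W = (\<integral>\<^sup>+x. ennreal (\<bar>u x\<bar> powr (2 * p - 2) * dist x0 x powr (- (2 * q - 2))) \<partial>m)"
  define E where "E = (\<integral>\<^sup>+x. (loc_lip u x)\<^sup>2 \<partial>m)"
  have "J < \<infinity>" unfolding J_def by (rule cone_weighted_finite[OF u]) (use q p N2 in auto)
  then obtain j where j: "J = ennreal j" "0 \<le> j" by (cases J) auto
  have "W < \<infinity>" unfolding W_def by (rule cone_weighted_finite[OF u]) (use q p N2 in auto)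
  then obtain w where w: "W = ennreal w" "0 \<le> w" by (cases W) auto
  have "E < \<infinity>" unfolding E_def by (rule Lip_c_energy_finite[OF u])
  then obtain e where e: "E = ennreal e" "0 \<le> e" by (cases E) auto
  define \<sigma> where "\<sigma> = (\<lambda>n::nat. 1 - 1 / real (n + 2))"
  define Q where "Q = (\<lambda>n. enn2real (plan_quotient_energy u \<pi> (\<sigma> n)))"
  have Q: "plan_quotient_energy u \<pi> (\<sigma> n) = ennreal (Q n)" for n
  proof -
    have "ennreal (L\<^sup>2) * emeasure m (ball x0 (2 * R)) < \<infinity>"
      using *(4) by (simp add: cone_ball ennreal_mult_less_top)
    then have "plan_quotient_energy u \<pi> (\<sigma> n) < \<infinity>"
      using plan_quotient_energy_le[OF \<pi> *(1), of "\<sigma> n"] by (rule le_less_trans[rotated])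
    then show ?thesis by (simp add: Q_def)
  qed
  define c where "c = N - q"
  have c: "0 < c" using q N2 by (simp add: c_def)
  define d where "d = N - (2 * q - 2)"
  have ineq: "((\<sigma> n powr (- c) - 1) / (1 - \<sigma> n))\<^sup>2 * j\<^sup>2 \<le> p\<^sup>2 * (\<sigma> n powr (- d) * w) * Q n" for n
    unfolding c_def d_def
  proof (rule plan_inequality[OF \<pi> *(4)])
    show "1 / 2 \<le> \<sigma> n" "\<sigma> n < 1" by (auto simp: \<sigma>_def field_simps)
    show "continuous_on UNIV u" using *(1) by (rule lipschitz_on_continuous_on)
  qed (use p *(5) j w Q c in \<open>auto simp: J_def W_def Q_def c_def\<close>)
  have lim1: "(\<lambda>n. ((\<sigma> n powr (- c) - 1) / (1 - \<sigma> n))\<^sup>2 * j\<^sup>2) \<longlonglongrightarrow> c\<^sup>2 * j\<^sup>2"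
  proof -
    have "(\<lambda>n. (\<sigma> n powr (- c) - 1) / (1 - \<sigma> n)) \<longlonglongrightarrow> c"
      unfolding \<sigma>_def using c by real_asymp
    then show ?thesis by (intro tendsto_intros)
  qed
  have lim2: "(\<lambda>n. \<sigma> n powr (- d)) \<longlonglongrightarrow> 1"
    unfolding \<sigma>_def by real_asymp
  \<comment> \<open>The upper limit of \<open>Q\<close> is at most \<open>e\<close>, so \<open>Q n < e + h\<close> for large \<open>n\<close>.\<close>
  have bound: "c\<^sup>2 * j\<^sup>2 \<le> p\<^sup>2 * (1 * w) * (e + h)" if h: "0 < h" for h
  proof (rule tendsto_le[OF _ _ lim1])
    show "(\<lambda>n. p\<^sup>2 * (\<sigma> n powr (- d) * w) * (e + h)) \<longlonglongrightarrow> p\<^sup>2 * (1 * w) * (e + h)"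
      by (intro tendsto_intros lim2)
    have "limsup (\<lambda>n. plan_quotient_energy u \<pi> (\<sigma> n)) \<le> ennreal e"
      using limsup_plan_quotient_energy[OF \<pi> \<open>0 < 2 * R\<close> *(1)] e
      by (simp only: E_def[symmetric] \<sigma>_def)
    also have "\<dots> < ennreal (e + h)" using e h by (simp add: ennreal_less_iff)
    finally have "\<forall>\<^sub>F n in sequentially. plan_quotient_energy u \<pi> (\<sigma> n) < ennreal (e + h)"
      by (rule Limsup_lessD)
    then show "\<forall>\<^sub>F n in sequentially. ((\<sigma> n powr (- c) - 1) / (1 - \<sigma> n))\<^sup>2 * j\<^sup>2
        \<le> p\<^sup>2 * (\<sigma> n powr (- d) * w) * (e + h)"
    proof eventually_elim
      case (elim n)
      then have "Q n \<le> e + h" unfolding Q by (metis ennreal_leI linorder_not_le less_imp_le)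
      then have "p\<^sup>2 * (\<sigma> n powr (- d) * w) * Q n \<le> p\<^sup>2 * (\<sigma> n powr (- d) * w) * (e + h)"
        using w by (intro mult_left_mono) auto
      with ineq[of n] show ?case by linarith
    qed
  qed simp
  have "(\<lambda>n. p\<^sup>2 * (1 * w) * (e + 1 / real (Suc n))) \<longlonglongrightarrow> p\<^sup>2 * (1 * w) * (e + 0)"
    by (intro tendsto_intros LIMSEQ_Suc[OF lim_inverse_n'])
  then have "c\<^sup>2 * j\<^sup>2 \<le> p\<^sup>2 * (1 * w) * (e + 0)"
    by (rule LIMSEQ_le_const) (use bound in force)
  then have "c\<^sup>2 / p\<^sup>2 * j\<^sup>2 \<le> e * w"
    using p by (simp add: field_simps)
  then have "ennreal (c\<^sup>2 / p\<^sup>2 * j\<^sup>2) \<le> ennreal (e * w)" by (rule ennreal_leI)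
  moreover have "ennreal (c\<^sup>2 / p\<^sup>2 * j\<^sup>2) = ennreal (c\<^sup>2 / p\<^sup>2) * J\<^sup>2"
    unfolding j(1) using j(2) by (subst ennreal_mult) (auto simp: ennreal_power)
  moreover have "ennreal (e * w) = E * W"
    unfolding e(1) w(1) using e(2) w(2) by (rule ennreal_mult)
  ultimately have "ennreal (c\<^sup>2 / p\<^sup>2) * J\<^sup>2 \<le> E * W" by simp
  moreover have "0 < p" "0 < 2 * p - 2" using p by auto
  ultimately show "ennreal ((N - q)\<^sup>2 / p\<^sup>2) * (\<integral>\<^sup>+ x. epowr \<bar>u x\<bar> p / epowr (dist x0 x) q \<partial>m)\<^sup>2
      \<le> (\<integral>\<^sup>+ x. (loc_lip u x)\<^sup>2 \<partial>m) *
        (\<integral>\<^sup>+ x. epowr \<bar>u x\<bar> (2 * p - 2) / epowr (dist x0 x) (2 * q - 2) \<partial>m)"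
    by (simp only: cone_weighted_eq J_def W_def E_def c_def)
qed

end

section \<open>The equivalence\<close>

context mcp_space
begin

lemma plateau_in_Lip_c: "(\<lambda>x :: 'a. max 0 (min 1 (2 - dist x0 x))) \<in> Lip_c"
proof -
  let ?u = "\<lambda>x :: 'a. max 0 (min 1 (2 - dist x0 x))"
  have "1-lipschitz_on UNIV ?u"
  proof (rule lipschitz_onI)
    fix x y :: 'a
    have "dist (?u x) (?u y) \<le> \<bar>dist x0 x - dist x0 y\<bar>"
      unfolding dist_real_def by linarith
    also have "\<dots> \<le> 1 * dist x y" using abs_dist_diff_le[of x x0 y] by (simp add: dist_commute)
    finally show "dist (?u x) (?u y) \<le> 1 * dist x y" .
  qed simp
  moreover have "closure {x. ?u x \<noteq> 0} \<subseteq> cball x0 2"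
    by (rule closure_minimal) auto
  then have "compact (closure {x. ?u x \<noteq> 0})"
    using compact_Int_closed[OF compact_cball_mcp closed_closure] by (metis inf.absorb2)
  ultimately show ?thesis by (auto simp: Lip_c_def)
qed

text \<open>
  Both statements are read off from the finite weighted mass of a plateau function: its integrand is
  infinite at the vertex and equals \<open>d powr (- q)\<close> on the rest of the unit ball.
\<close>
lemma CKN_finite_imp_vertex:
  assumes fin: "CKN_integrals_finite m p q x0" and q: "0 < q"
  shows "emeasure m {x0} = 0"
    and "(\<integral>\<^sup>+x. ennreal (dist x0 x powr (- q)) * indicator (ball x0 1) x \<partial>m) < \<infinity>"
proof -
  let ?u = "\<lambda>x :: 'a. max 0 (min 1 (2 - dist x0 x))"
  let ?f = "\<lambda>x :: 'a. epowr \<bar>?u x\<bar> p / epowr (dist x0 x) q"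
  have f: "(\<integral>\<^sup>+x. ?f x \<partial>m) < \<infinity>"
    using bspec[OF fin[unfolded CKN_integrals_finite_def] plateau_in_Lip_c[of x0]] by (elim conjE)
  have "\<top> * emeasure m {x0} = (\<integral>\<^sup>+x. \<top> * indicator {x0} x \<partial>m)"
    by (rule nn_integral_cmult_indicator[symmetric]) simp
  also have "\<dots> \<le> (\<integral>\<^sup>+x. ?f x \<partial>m)"
    using q by (intro nn_integral_mono) (auto simp: epowr_def divide_ennreal_def split: split_indicator)
  finally show "emeasure m {x0} = 0" using f by (auto simp: ennreal_top_mult split: if_splits)
  have "(\<integral>\<^sup>+x. ennreal (dist x0 x powr (- q)) * indicator (ball x0 1) x \<partial>m) \<le> (\<integral>\<^sup>+x. ?f x \<partial>m)"
  proof (rule nn_integral_mono)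
    fix x
    show "ennreal (dist x0 x powr (- q)) * indicator (ball x0 1) x \<le> ?f x"
    proof (cases "0 < dist x0 x \<and> dist x0 x < 1")
      case True
      then have "?f x = ennreal (dist x0 x powr (- q))"
        by (auto simp: epowr_def powr_minus divide_ennreal_def inverse_ennreal)
      then show ?thesis using True by simp
    qed (auto split: split_indicator)
  qed
  then show "(\<integral>\<^sup>+x. ennreal (dist x0 x powr (- q)) * indicator (ball x0 1) x \<partial>m) < \<infinity>"
    using f by (rule le_less_trans)
qed

end

theorem theorem1p2:
  fixes m :: "'a::polish_space measure" and N p q :: real
  assumes "0 < q" and "q < 2" and "2 < p"
    and "2 < N" and "N < 2 * (p - q) / (p - 2)"
    and "metric_measure_space m"
    and "geodesic_space TYPE('a)"
    and "essentially_nonbranching m"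
    and "MCP0 m N"
  shows "(\<exists>x0. CKN_integrals_finite m p q x0 \<and>
               CKN_inequality m p q x0 ((N - q)\<^sup>2 / p\<^sup>2) \<and>
               sharp_constant (CKN_inequality m p q x0) ((N - q)\<^sup>2 / p\<^sup>2))
         \<longleftrightarrow> volume_cone m N"
proof
  interpret mcp_space m N by unfold_locales (use assms in auto)
  {
    assume "\<exists>x0. CKN_integrals_finite m p q x0 \<and>
        CKN_inequality m p q x0 ((N - q)\<^sup>2 / p\<^sup>2) \<and>
        sharp_constant (CKN_inequality m p q x0) ((N - q)\<^sup>2 / p\<^sup>2)"
    then obtain x0 where fin: "CKN_integrals_finite m p q x0"
      and ckn: "CKN_inequality m p q x0 ((N - q)\<^sup>2 / p\<^sup>2)" by blast
    interpret ckn_vertex m N p q x0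
      by unfold_locales (use assms CKN_finite_imp_vertex[OF fin assms(1)] in auto)
    show "volume_cone m N"
      unfolding volume_cone_def
    proof (intro exI allI impI)
      fix r R :: real assume r: "0 < r \<and> r < R"
      have "measure m (ball x0 R) = (R / r) powr N * measure m (ball x0 r)"
        using CKN_imp_ball_scaling[OF ckn, of r R] r by (simp add: measure_def enn2real_mult)
      moreover have "0 < measure m (ball x0 r)"
        using emeasure_ball_pos_finite[OF mms, of r x0] r by (simp add: measure_def enn2real_positive_iff)
      ultimately show "measure m (ball x0 R) / measure m (ball x0 r) = (R / r) powr N" by simp
    qed
  next
    assume "volume_cone m N"
    then obtain x0 where cone: "\<And>r R. 0 < r \<Longrightarrow> r < R \<Longrightarrow>
        measure m (ball x0 R) / measure m (ball x0 r) = (R / r) powr N"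
      unfolding volume_cone_def by blast
    interpret cone: mcp_cone m N x0 "measure m (ball x0 1)"
      by unfold_locales (use cone_emeasure_ball[OF cone] in auto)
    interpret ckn_vertex m N p q x0
      by unfold_locales
        (use assms cone.cone_no_atom cone.cone_inverse_power_integrable[of q 1] in auto)
    have "sharp_constant (CKN_inequality m p q x0) ((N - q)\<^sup>2 / p\<^sup>2)"
      unfolding sharp_constant_def using CKN_constant_upper_bound not_le by blast
    then show "\<exists>x0. CKN_integrals_finite m p q x0 \<and>
        CKN_inequality m p q x0 ((N - q)\<^sup>2 / p\<^sup>2) \<and>
        sharp_constant (CKN_inequality m p q x0) ((N - q)\<^sup>2 / p\<^sup>2)"
      using cone.cone_CKN_integrals_finite cone.cone_CKN_inequality assms by blast
  }
qed

end
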